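(* Let $1\le p\le n$. For $\hat U\in\mathrm{St}(n,p)$ with orthogonal completion $\widehat{\mathbf{Q}}=[\hat U\ \ \hat U_\perp]\in O(n)$, let $$ \varphi_{\hat U}: T_{\hat U}\mathrm{St}(n,p)\to\mathrm{St}(n,p),\qquad \varphi_{\hat U}\!\left(\widehat{\mathbf{Q}}\begin{bmatrix} A\\ B\end{bmatrix}\right)=\widehat{\mathbf{Q}}\begin{bmatrix}\exp_m(A)\\ B\end{bmatrix}(I_p+B^TB)^{-\frac12}, $$ where $A\in\mathrm{skew}(p)$ and $B\in\mathbb{R}^{(n-p)\times p}$. Then the family of maps $\{\varphi_{\hat U}\mid \hat U\in\mathrm{St}(n,p)\}$ is a retraction on $\mathrm{St}(n,p)$ under any metric of the one-parameter family of $\beta$-metrics. Under the Euclidean metric ($\beta=1$), it is a retraction of second order.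
   Context: $\mathrm{St}(n,p)=\{U\in\mathbb{R}^{n\times p}\mid U^TU=I_p\}$ is the Stiefel manifold, $\mathrm{skew}(p)$ is the space of real skew-symmetric $p\times p$ matrices, $\exp_m$ is the matrix exponential, and $(\cdot)^{-\frac12}$ is the inverse of the symmetric positive definite square root. For $\hat U\in \mathrm{St}(n,p)$ with $\widehat{\mathbf{Q}}=[\hat U\ \ \hat U_\perp]\in O(n)$, the tangent space is $T_{\hat U}\mathrm{St}(n,p)=\left\{\widehat{\mathbf{Q}}\begin{bmatrix} A\\ B\end{bmatrix}\mid A\in\mathrm{skew}(p),\,B\in\mathbb{R}^{(n-p)\times p}\right\}$. The map $\varphi_{\hat U}$ can be written without the completion as $$\varphi_{\hat U}(\xi)=\left(\hat U\exp_m(\hat U^T\xi)+(I_n-\hat U\hat U^T)\xi\right)\left(I_p+\xi^T(I_n-\hat U\hat U^T)\xi\right)^{-\frac12},$$ so it does not depend on the choice of $\hat U_\perp$. One-parameter family of metrics: for $\beta>0$, the $\beta$-metric on $T_{\hat U}\mathrm{St}(n,p)$ is $\left\langle \widehat{\mathbf{Q}}\begin{bmatrix} A\\ B\end{bmatrix},\widehat{\mathbf{Q}}\begin{bmatrix}\tilde A\\ \tilde B\end{bmatrix}\right\rangle=\beta\,\mathrm{tr}(A^T\tilde A)+\mathrm{tr}(B^T\tilde B)$; $\beta=\frac12$ is the canonical metric and $\beta=1$ is the Euclidean metric. Its Riemannian exponential is $$\mathrm{Exp}_{\hat U}\!\left(\widehat{\mathbf{Q}}\begin{bmatrix} A\\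 B\end{bmatrix}\right)=\widehat{\mathbf{Q}}\exp_m\!\left(\begin{bmatrix}2\beta A&-B^T\\ B&0\end{bmatrix}\right)\begin{bmatrix}I_p\\ 0\end{bmatrix}\exp_m((1-2\beta)A).$$ A family of maps $R_{\hat U}:T_{\hat U}\mathrm{St}(n,p)\to\mathrm{St}(n,p)$, depending smoothly on $(\hat U,\xi)$ in the tangent bundle, is a retraction of order $k$ (under a given metric) if for every $\hat U$ the map $\xi\mapsto R_{\hat U}(\xi)$ coincides with the Taylor expansion of $\xi\mapsto\mathrm{Exp}_{\hat U}(\xi)$ around $0\in T_{\hat U}\mathrm{St}(n,p)$ up to and including the terms of $k$-th order. A retraction (without further specification) is a retraction of order at least one, i.e. $R_{\hat U}(0)=\hat U$ and $D(R_{\hat U})_0=\mathrm{id}_{T_{\hat U}\mathrm{St}(n,p)}$. *)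

theory Defs
  imports "HOL-Analysis.Analysis"
begin

section \<open>Block matrices\<close>

text \<open>
  An n-by-p real matrix has type \<open>real^'p^'n\<close>, where n = CARD('n) and p = CARD('p); both are at
  least 1, and p \<le> n is a hypothesis of the theorem. There is no type with n - p elements that
  also covers n = p, so blocks with n - p rows (columns) are indexed by \<open>'n\<close>. The injection
  \<open>lead\<close> selects the p rows (columns) of the leading block, and a trailing block only uses the
  rows (columns) outside the range of \<open>lead\<close>. The selected positions are irrelevant: another
  injection amounts to permuting the columns of the completion.
\<close>

definition lead :: "'p::finite \<Rightarrow> 'n::finite"
  where "lead = (SOME f. inj f)"

definition vstack :: "'a^'p \<Rightarrow> 'a^'n \<Rightarrow> 'a^'n::finite"
  where "vstack A B =
    (\<chi> i. if i \<in> range (lead :: 'p::finite \<Rightarrow> 'n) then A $ inv lead i else B $ i)"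

definition hstack :: "'a^'p^'m \<Rightarrow> 'a^'n^'m \<Rightarrow> 'a^'n::finite^'m::finite"
  where "hstack A B = transpose (vstack (transpose A) (transpose B))"

text \<open>
  The matrices with n - p rows and p columns: the unused leading rows are zero, so that
  \<open>transpose B ** B\<close> is the product of the actual (n - p)-by-p blocks.
\<close>

definition trailing_rows :: "(real^'p^'n) set"
  where "trailing_rows = {B. \<forall>j::'p::finite. B $ (lead j :: 'n::finite) = 0}"

section \<open>Matrix functions\<close>

text \<open>The \<open>*\<close> and \<open>^\<close> of the type \<open>vec\<close> act componentwise, hence the explicit powers.\<close>

definition matexp :: "real^'m^'m \<Rightarrow> real^'m^'m"
  where "matexp A = (\<Sum>k. (1 / fact k) *\<^sub>R (((**) A ^^ k) (mat 1)))"

definition skew :: "(real^'p^'p) set"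
  where "skew = {A. transpose A = - A}"

definition spd :: "real^'p^'p \<Rightarrow> bool"
  where "spd S \<longleftrightarrow> transpose S = S \<and> (\<forall>x. x \<noteq> 0 \<longrightarrow> 0 < x \<bullet> (S *v x))"

definition inv_sqrt :: "real^'p^'p \<Rightarrow> real^'p^'p"
  where "inv_sqrt M = matrix_inv (THE S. spd S \<and> S ** S = M)"

section \<open>The Stiefel manifold\<close>

definition stiefel :: "(real^'p^'n) set"
  where "stiefel = {U. transpose U ** U = mat 1}"

definition orth_completion :: "real^'p^'n \<Rightarrow> real^'n^'n \<Rightarrow> bool"
  where "orth_completion U Q \<longleftrightarrow> orthogonal_matrix Q \<and> (\<exists>U'. Q = hstack U U')"

text \<open>
  The next three definitions range over all orthogonal completions of \<open>U\<close>. They do not depend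
  on the completion, see \<open>tangent_space_eq\<close>, \<open>stiefel_exp_eq\<close> and \<open>stiefel_phi_eq\<close> below.
\<close>

definition tangent_space :: "real^'p^'n \<Rightarrow> (real^'p^'n) set"
  where "tangent_space U =
    {Q ** vstack A B | Q A B. orth_completion U Q \<and> A \<in> skew \<and> B \<in> trailing_rows}"

text \<open>
  The Riemannian exponential at \<open>U\<close> for the metric
  \<open>\<beta> tr(A\<^sup>T A') + tr(B\<^sup>T B')\<close> on tangent vectors \<open>Q [A; B]\<close> and \<open>Q [A'; B']\<close>, given by
  its known closed form.
\<close>

definition stiefel_exp :: "real \<Rightarrow> real^'p^'n \<Rightarrow> real^'p^'n \<Rightarrow> real^'p^'n"
  where "stiefel_exp \<beta> U \<xi> = (THE X. \<exists>Q A B.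
    orth_completion U Q \<and> A \<in> skew \<and> B \<in> trailing_rows \<and> \<xi> = Q ** vstack A B \<and>
    X = Q ** matexp (hstack (vstack ((2 * \<beta>) *\<^sub>R A) B) (vstack (- transpose B) 0))
          ** vstack (mat 1) 0 ** matexp ((1 - 2 * \<beta>) *\<^sub>R A))"

definition stiefel_phi :: "real^'p^'n \<Rightarrow> real^'p^'n \<Rightarrow> real^'p^'n"
  where "stiefel_phi U \<xi> = (THE X. \<exists>Q A B.
    orth_completion U Q \<and> A \<in> skew \<and> B \<in> trailing_rows \<and> \<xi> = Q ** vstack A B \<and>
    X = Q ** vstack (matexp A) B ** inv_sqrt (mat 1 + transpose B ** B))"

section \<open>Retractions\<close>

text \<open>Continuous differentiability of order \<open>k\<close> on an open set \<open>W\<close>.\<close>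

primrec Ck_on :: "nat \<Rightarrow> ('a::euclidean_space \<Rightarrow> 'b::euclidean_space) \<Rightarrow> 'a set \<Rightarrow> bool"
  where
    "Ck_on 0 f W \<longleftrightarrow> continuous_on W f"
  | "Ck_on (Suc k) f W \<longleftrightarrow> f differentiable_on W \<and>
       (\<forall>v. Ck_on k (\<lambda>x. frechet_derivative f (at x) v) W)"

text \<open>
  Smoothness on an arbitrary subset of a Euclidean space: local smooth extendability. On an
  embedded submanifold this is smoothness in the sense of manifolds.
\<close>

definition smooth_map_on :: "('a::euclidean_space) set \<Rightarrow> ('a \<Rightarrow> 'b::euclidean_space) \<Rightarrow> bool"
  where "smooth_map_on X f \<longleftrightarrow> (\<forall>x\<in>X. \<exists>W g. open W \<and> x \<in> W \<and>
    (\<forall>k. Ck_on k g W) \<and> (\<forall>y\<in>X \<inter> W. g y = f y))"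

definition tangent_bundle :: "((real^'p^'n) \<times> (real^'p^'n)) set"
  where "tangent_bundle = (SIGMA U:stiefel. tangent_space U)"

text \<open>
  The homogeneous term of degree \<open>j\<close> in the Taylor expansion of \<open>f\<close> around 0,
  \<open>(1/j!) D\<^sup>jf(0)[\<xi>,\<dots>,\<xi>] = (1/j!) d\<^sup>j/dt\<^sup>j f(t\<xi>)\<close> at \<open>t = 0\<close>. In the second form \<open>f\<close> is
  only evaluated on the line spanned by \<open>\<xi>\<close>, as needed for maps on a linear subspace.
\<close>

definition taylor_term ::
    "('a::real_normed_vector \<Rightarrow> 'b::real_normed_vector) \<Rightarrow> nat \<Rightarrow> 'a \<Rightarrow> 'b"
  where "taylor_term f j \<xi> = (1 / fact j) *\<^sub>R
    ((\<lambda>c t. vector_derivative c (at t)) ^^ j) (\<lambda>t. f (t *\<^sub>R \<xi>)) 0"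

definition retraction_of_order ::
    "real \<Rightarrow> nat \<Rightarrow> (real^'p^'n \<Rightarrow> real^'p^'n \<Rightarrow> real^'p^'n) \<Rightarrow> bool"
  where "retraction_of_order \<beta> k R \<longleftrightarrow>
    (\<forall>U\<in>stiefel. \<forall>\<xi>\<in>tangent_space U. R U \<xi> \<in> stiefel) \<and>
    smooth_map_on tangent_bundle (\<lambda>(U, \<xi>). R U \<xi>) \<and>
    (\<forall>U\<in>stiefel. \<forall>j\<le>k. \<forall>\<xi>\<in>tangent_space U.
       taylor_term (R U) j \<xi> = taylor_term (stiefel_exp \<beta> U) j \<xi>)"

abbreviation is_retraction ::
    "real \<Rightarrow> (real^'p^'n \<Rightarrow> real^'p^'n \<Rightarrow> real^'p^'n) \<Rightarrow> bool"
  where "is_retraction \<beta> R \<equiv> retraction_of_order \<beta> 1 R"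

section \<open>Independence of the completion\<close>

lemma inj_lead:
  assumes "CARD('p) \<le> CARD('n)"
  shows "inj (lead :: 'p::finite \<Rightarrow> 'n::finite)"
proof -
  have "\<exists>f :: 'p \<Rightarrow> 'n. inj f"
    using assms card_le_inj[of "UNIV :: 'p set" "UNIV :: 'n set"] by auto
  then show ?thesis
    unfolding lead_def by (rule someI_ex)
qed

lemma matrix_mult_linear:
  fixes A B :: "real^'k^'m" and C D :: "real^'l^'k"
  shows "(A + B) ** C = A ** C + B ** C" "A ** (C + D) = A ** C + A ** D"
    "(A - B) ** C = A ** C - B ** C" "A ** (C - D) = A ** C - A ** D"
  by (simp_all add: vec_eq_iff matrix_matrix_mult_def distrib_left distrib_right
      left_diff_distrib right_diff_distrib sum.distrib sum_subtractf)

lemma matrix_mult_scaleR: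
  fixes A :: "real^'k^'m" and C :: "real^'l^'k"
  shows "(r *\<^sub>R A) ** C = r *\<^sub>R (A ** C)" "A ** (r *\<^sub>R C) = r *\<^sub>R (A ** C)"
  by (simp_all add: vec_eq_iff matrix_matrix_mult_def sum_distrib_left mult.left_commute
      mult.assoc)

lemma mat_pow_norm_le:
  "\<exists>K\<ge>0. \<forall>(A::real^'m^'m) k.
    norm (((**) A ^^ k) (mat 1)) \<le> (norm A * K) ^ k * norm (mat 1 :: real^'m^'m)"
proof -
  have "bounded_bilinear ((**) :: real^'m^'m \<Rightarrow> real^'m^'m \<Rightarrow> real^'m^'m)"
    by (simp add: bilinear_conv_bounded_bilinear[symmetric] bilinear_def linear_iff
        matrix_mult_linear matrix_mult_scaleR)
  from bounded_bilinear.nonneg_bounded[OF this] obtain K where K: "0 \<le> K" "\<forall>(A::real^'m^'m) (B::real^'m^'m). norm (A ** B) \<le> norm A * norm B * K"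
    by blast
  have "norm (((**) A ^^ k) (mat 1)) \<le> (norm A * K) ^ k * norm (mat 1 :: real^'m^'m)"
    for A :: "real^'m^'m" and k
  proof (induction k)
    case (Suc k)
    have "norm (A ** ((**) A ^^ k) (mat 1)) \<le> norm A * norm (((**) A ^^ k) (mat 1)) * K"
      using K(2) by simp
    also have "\<dots> = (norm A * K) * norm (((**) A ^^ k) (mat 1))"
      by simp
    also have "\<dots> \<le> (norm A * K) * ((norm A * K) ^ k * norm (mat 1 :: real^'m^'m))"
      by (rule mult_left_mono[OF Suc]) (simp add: K)
    finally show ?case by (simp add: mult.assoc)
  qed simp
  then show ?thesis using K(1) by blast
qed

lemma summable_matexp:
  fixes A :: "real^'m^'m"
  shows "summable (\<lambda>k. (1 / fact k) *\<^sub>R (((**) A ^^ k) (mat 1)))"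
proof -
  obtain K where K: "norm (((**) A ^^ k) (mat 1)) \<le> (norm A * K) ^ k * norm (mat 1 :: real^'m^'m)" for k
    using mat_pow_norm_le[where 'm='m] by blast
  have "summable (\<lambda>k. inverse (fact k) * (norm A * K) ^ k * norm (mat 1 :: real^'m^'m))"
    by (intro summable_mult2 summable_exp)
  then show ?thesis
  proof (rule summable_comparison_test')
    fix k :: nat
    show "norm ((1 / fact k) *\<^sub>R (((**) A ^^ k) (mat 1)))
        \<le> inverse (fact k) * (norm A * K) ^ k * norm (mat 1 :: real^'m^'m)"
      using mult_left_mono[OF K[of k], of "inverse (fact k)"]
      by (simp add: divide_inverse mult.assoc)
  qed
qed

lemma matexp_orth_conj:
  fixes Q M :: "real^'m^'m"
  assumes "transpose Q ** Q = mat 1" "Q ** transpose Q = mat 1"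
  shows "Q ** matexp M = matexp (Q ** M ** transpose Q) ** Q"
proof -
  let ?N = "Q ** M ** transpose Q"
  have pow: "((**) ?N ^^ k) (mat 1) = Q ** ((**) M ^^ k) (mat 1) ** transpose Q" for k
  proof (induction k)
    case (Suc k)
    have "((**) ?N ^^ Suc k) (mat 1) =
        Q ** M ** (transpose Q ** Q) ** ((**) M ^^ k) (mat 1) ** transpose Q"
      by (simp add: Suc matrix_mul_assoc)
    then show ?case by (simp add: assms matrix_mul_assoc)
  qed (simp add: assms)
  have bl: "bounded_linear (\<lambda>X :: real^'m^'m. Q ** X ** transpose Q)"
    by (simp add: linear_conv_bounded_linear[symmetric] linear_iff
        matrix_mult_linear matrix_mult_scaleR)
  have "matexp ?N = Q ** matexp M ** transpose Q"
    using bounded_linear.suminf[OF bl summable_matexp[of M]]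
    by (simp add: matexp_def pow matrix_mult_scaleR)
  then have "matexp ?N ** Q = Q ** matexp M ** (transpose Q ** Q)"
    by (simp add: matrix_mul_assoc)
  then show ?thesis by (simp add: assms)
qed

context
  fixes dummy_p :: "'p::finite itself" and dummy_n :: "'n::finite itself"
  assumes card_le: "CARD('p) \<le> CARD('n)"
begin

lemma vstack_lead: "(vstack A B :: 'a^'n) $ lead (j::'p) = A $ j"
  using inj_lead[OF card_le] by (simp add: vstack_def)

lemma vstack_other: "i \<notin> range (lead :: 'p \<Rightarrow> 'n) \<Longrightarrow> vstack (A :: 'a^'p) B $ i = B $ i"
  by (simp add: vstack_def)

lemma vstack_trailing: "B \<in> trailing_rows \<Longrightarrow> vstack (0 :: real^'p^'p) B = (B :: real^'p^'n)"
  by (auto simp: vec_eq_iff trailing_rows_def vstack_def f_inv_into_f)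

lemma sum_lead: "(\<Sum>i\<in>UNIV. f (i::'n)) =
    (\<Sum>j\<in>UNIV. f (lead (j::'p))) + (\<Sum>i\<in>- range (lead :: 'p \<Rightarrow> 'n). f i)"
  for f :: "'n \<Rightarrow> real"
proof -
  have "(\<Sum>i\<in>UNIV. f i) =
      (\<Sum>i\<in>range (lead :: 'p \<Rightarrow> 'n). f i) + (\<Sum>i\<in>- range (lead :: 'p \<Rightarrow> 'n). f i)"
    by (metis Compl_eq_Diff_UNIV add.commute finite_code subset_UNIV sum.subset_diff)
  also have "(\<Sum>i\<in>range (lead :: 'p \<Rightarrow> 'n). f i) = (\<Sum>j\<in>UNIV. f (lead (j::'p)))"
    using inj_lead[OF card_le] by (simp add: sum.reindex)
  finally show ?thesis .
qed

lemma completion_lead: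
  assumes "orth_completion (U :: real^'p^'n) Q"
  shows "Q $ i $ lead (j::'p) = U $ i $ j"
  using assms by (auto simp: orth_completion_def hstack_def transpose_def vstack_lead)

lemma completion_orth:
  assumes "orth_completion (U :: real^'p^'n) Q"
  shows "transpose Q ** Q = mat 1" "Q ** transpose Q = mat 1"
  using assms by (auto simp: orth_completion_def orthogonal_matrix_def)

lemma completion_vstack:
  fixes B :: "real^'k^'n"
  assumes "orth_completion (U :: real^'p^'n) Q"
  shows "Q ** vstack A B = U ** A + Q ** vstack (0 :: real^'k^'p) B"
proof -
  have "(Q ** vstack A B) $ i $ k = (U ** A + Q ** vstack (0 :: real^'k^'p) B) $ i $ k" for i k
    unfolding matrix_matrix_mult_def
    by (simp add: sum_lead vstack_lead vstack_other completion_lead[OF assms])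
  then show ?thesis by (simp add: vec_eq_iff)
qed

lemma completion_cong:
  assumes "orth_completion (U :: real^'p^'n) Q"
  shows "transpose U ** X = (\<chi> j. (transpose Q ** X) $ lead j)"
  by (simp add: vec_eq_iff matrix_matrix_mult_def transpose_def completion_lead[OF assms])

lemma completion_unique:
  fixes U B :: "real^'p^'n"
  assumes "orth_completion U Q" "B \<in> trailing_rows" "\<xi> = Q ** vstack A B"
  shows "A = transpose U ** \<xi>" "Q ** B = \<xi> - U ** (transpose U ** \<xi>)"
proof -
  have "transpose Q ** \<xi> = vstack A B"
    by (simp add: assms(3) matrix_mul_assoc completion_orth[OF assms(1)])
  then show A: "A = transpose U ** \<xi>"
    by (simp add: completion_cong[OF assms(1)] vstack_lead vec_eq_iff)
  have "\<xi> = U ** A + Q ** B"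
    using completion_vstack[OF assms(1), of A B]
    by (simp only: vstack_trailing[OF assms(2)] assms(3))
  then have "Q ** B = \<xi> - U ** A"
    by simp
  then show "Q ** B = \<xi> - U ** (transpose U ** \<xi>)"
    by (simp only: A[symmetric])
qed

lemma stiefel_phi_closed:
  fixes U B :: "real^'p^'n"
  assumes "orth_completion U Q" "B \<in> trailing_rows" "\<xi> = Q ** vstack A B"
  defines "V \<equiv> \<xi> - U ** (transpose U ** \<xi>)"
  shows "Q ** vstack (matexp A) B ** inv_sqrt (mat 1 + transpose B ** B) =
    (U ** matexp (transpose U ** \<xi>) + V) ** inv_sqrt (mat 1 + transpose V ** V)"
proof -
  have V: "V = Q ** B" and A: "A = transpose U ** \<xi>"
    using completion_unique[OF assms(1-3)] by (simp_all add: V_def)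
  have "transpose V ** V = transpose B ** (transpose Q ** Q) ** B"
    by (simp add: V matrix_transpose_mul matrix_mul_assoc)
  then have "transpose V ** V = transpose B ** B"
    by (simp add: completion_orth[OF assms(1)])
  moreover have "Q ** vstack (matexp A) B = U ** matexp (transpose U ** \<xi>) + V"
    using completion_vstack[OF assms(1), of "matexp A" B]
    by (simp add: A[symmetric] V vstack_trailing[OF assms(2)])
  ultimately show ?thesis by simp
qed

lemma tangent_space_eq:
  fixes U :: "real^'p^'n"
  assumes "orth_completion U Q"
  shows "tangent_space U = {Q ** vstack A B | A B. A \<in> skew \<and> B \<in> trailing_rows}"
proof -
  have "\<exists>B'\<in>trailing_rows. P ** vstack A B = Q ** vstack A B'"
    if P: "orth_completion U P" and B: "B \<in> trailing_rows" for P :: "real^'n^'n" and A :: "real^'p^'p" and B :: "real^'p^'n"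
  proof
    define \<xi> where "\<xi> = P ** vstack A B"
    have A: "A = transpose U ** \<xi>"
      using completion_unique[OF P B \<xi>_def] by simp
    define B' :: "real^'p^'n" where "B' = vstack (0 :: real^'p^'p) (transpose Q ** \<xi>)"
    show "B' \<in> trailing_rows"
      by (simp add: B'_def trailing_rows_def vstack_lead)
    have "vstack A B' $ i = (transpose Q ** \<xi>) $ i" for i
    proof (cases "i \<in> range (lead :: 'p \<Rightarrow> 'n)")
      case True
      then obtain j :: 'p where "i = lead j" by blast
      then show ?thesis
        by (simp add: vstack_lead A completion_cong[OF assms])
    qed (simp add: vstack_other B'_def)
    then have "vstack A B' = transpose Q ** \<xi>"
      by (simp add: vec_eq_iff)
    then show "P ** vstack A B = Q ** vstack A B'"
      by (simp add: matrix_mul_assoc completion_orth[OF assms] flip: \<xi>_def)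
  qed
  then show ?thesis
    using assms unfolding tangent_space_def by blast
qed

lemma stiefel_exp_closed:
  fixes U B :: "real^'p^'n"
  assumes "orth_completion U Q" "B \<in> trailing_rows" "\<xi> = Q ** vstack A B"
  defines "V \<equiv> \<xi> - U ** (transpose U ** \<xi>)"
  shows "Q ** matexp (hstack (vstack ((2 * \<beta>) *\<^sub>R A) B) (vstack (- transpose B) 0))
          ** vstack (mat 1) 0 ** matexp ((1 - 2 * \<beta>) *\<^sub>R A) =
    matexp ((U ** ((2 * \<beta>) *\<^sub>R (transpose U ** \<xi>)) + V) ** transpose U - U ** transpose V)
      ** U ** matexp ((1 - 2 * \<beta>) *\<^sub>R (transpose U ** \<xi>))"
proof -
  have V: "V = Q ** B" and A: "A = transpose U ** \<xi>"
    using completion_unique[OF assms(1-3)] by (simp_all add: V_def)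
  have U: "Q ** vstack (mat 1) (0 :: real^'p^'n) = U"
  proof -
    have "vstack (0 :: real^'p^'p) (0 :: real^'p^'n) = 0"
      by (rule vstack_trailing) (simp add: trailing_rows_def)
    then show ?thesis
      using completion_vstack[OF assms(1), of "mat 1" "0 :: real^'p^'n"] by simp
  qed
  define X where "X = vstack ((2 * \<beta>) *\<^sub>R A) B"
  define E :: "real^'p^'n" where "E = vstack (mat 1) 0"
  have QX: "Q ** X = U ** ((2 * \<beta>) *\<^sub>R A) + V"
    using completion_vstack[OF assms(1), of "(2 * \<beta>) *\<^sub>R A" B]
    by (simp add: X_def V vstack_trailing[OF assms(2)])
  have split: "hstack X (vstack (- transpose B) (0 :: real^'n^'n)) =
      X ** transpose E - E ** transpose B"
  proof -
    have "hstack X (vstack (- transpose B) (0 :: real^'n^'n)) $ i $ k =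
        (X ** transpose E - E ** transpose B) $ i $ k" for i k
    proof -
      have tail: "Bl = 0" if "Bl = B $ lead (j::'p)" for j Bl
        using assms(2) that by (simp add: trailing_rows_def)
      have mat1: "(\<Sum>j\<in>UNIV. F j * (if j = a then 1 else 0)) = (F a :: real)"
        "(\<Sum>j\<in>UNIV. (if a = j then 1 else 0) * F j) = (F a :: real)" for F and a :: 'p
      proof -
        have "F j * (if j = a then 1 else 0) = (if j = a then F j else 0)"
          "(if a = j then 1 else 0) * F j = (if a = j then F j else 0)" for j
          by auto
        then show "(\<Sum>j\<in>UNIV. F j * (if j = a then 1 else 0)) = F a"
          "(\<Sum>j\<in>UNIV. (if a = j then 1 else 0) * F j) = F a"
          by simp_all
      qed
      have E_lead: "E $ lead (a::'p) $ b = (if a = b then 1 else 0)" for a b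
        by (simp add: E_def vstack_lead mat_def)
      have E_other: "E $ i $ b = 0" if "i \<notin> range (lead :: 'p \<Rightarrow> 'n)" for i b
        using that by (simp add: E_def vstack_other)
      have h_lead: "hstack X Y $ i $ lead (a::'p) = X $ i $ a" for Y :: "real^'n^'n" and i a
        by (simp add: hstack_def transpose_def vstack_lead)
      have h_other: "hstack X Y $ i $ k = Y $ i $ k"
        if "k \<notin> range (lead :: 'p \<Rightarrow> 'n)" for Y :: "real^'n^'n" and i k
        using that by (simp add: hstack_def transpose_def vstack_other)
      have XE: "(X ** transpose E) $ i $ lead (a::'p) = X $ i $ a" for i a
        by (simp add: matrix_matrix_mult_def transpose_def E_lead mat1 eq_commute[of a])
      have XE0: "(X ** transpose E) $ i $ k = 0" if "k \<notin> range (lead :: 'p \<Rightarrow> 'n)" for i k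
        using that by (simp add: matrix_matrix_mult_def transpose_def E_other)
      have EB: "(E ** transpose B) $ lead (a::'p) $ k = B $ k $ a" for a k
        by (simp add: matrix_matrix_mult_def transpose_def E_lead mat1)
      have EB0: "(E ** transpose B) $ i $ k = 0" if "i \<notin> range (lead :: 'p \<Rightarrow> 'n)" for i k
        using that by (simp add: matrix_matrix_mult_def transpose_def E_other)
      have EBl: "(E ** transpose B) $ i $ lead (a::'p) = 0" for i a
        by (simp add: matrix_matrix_mult_def transpose_def tail[OF refl])
      show ?thesis
      proof (cases "k \<in> range (lead :: 'p \<Rightarrow> 'n)")
        case True
        then show ?thesis by (auto simp: h_lead XE EBl)
      next
        case k: False
        show ?thesis
        proof (cases "i \<in> range (lead :: 'p \<Rightarrow> 'n)")
          case True
          then show ?thesis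
            using k by (auto simp: h_other XE0 EB vstack_lead) (simp add: transpose_def)
        next
          case False
          then show ?thesis
            using k by (simp add: h_other XE0 EB0 vstack_other)
        qed
      qed
    qed
    then show ?thesis by (simp add: vec_eq_iff)
  qed
  have QE: "Q ** E = U"
    using U by (simp add: E_def)
  have "Q ** (X ** transpose E - E ** transpose B) ** transpose Q =
      (Q ** X) ** transpose (Q ** E) - (Q ** E) ** transpose (Q ** B)"
    by (simp add: matrix_transpose_mul matrix_mul_assoc matrix_mult_linear)
  also have "\<dots> = (U ** ((2 * \<beta>) *\<^sub>R A) + V) ** transpose U - U ** transpose V"
    by (simp only: QX QE flip: V)
  finally have conj: "Q ** hstack X (vstack (- transpose B) 0) ** transpose Q =
      (U ** ((2 * \<beta>) *\<^sub>R A) + V) ** transpose U - U ** transpose V"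
    by (simp only: split)
  have "Q ** matexp (hstack X (vstack (- transpose B) 0)) ** E =
      matexp ((U ** ((2 * \<beta>) *\<^sub>R A) + V) ** transpose U - U ** transpose V) ** (Q ** E)"
    by (simp only: matexp_orth_conj[OF completion_orth[OF assms(1)]] conj matrix_mul_assoc)
  then have "Q ** matexp (hstack X (vstack (- transpose B) 0)) ** E =
      matexp ((U ** ((2 * \<beta>) *\<^sub>R A) + V) ** transpose U - U ** transpose V) ** U"
    by (simp only: QE)
  then show ?thesis
    by (simp only: X_def E_def flip: A)
qed

lemma stiefel_exp_eq:
  fixes U :: "real^'p^'n"
  assumes "orth_completion U Q" "A \<in> skew" "B \<in> trailing_rows"
  shows "stiefel_exp \<beta> U (Q ** vstack A B) =
    Q ** matexp (hstack (vstack ((2 * \<beta>) *\<^sub>R A) B) (vstack (- transpose B) 0))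
      ** vstack (mat 1) 0 ** matexp ((1 - 2 * \<beta>) *\<^sub>R A)"
  unfolding stiefel_exp_def
proof (rule the_equality)
  fix X
  assume "\<exists>Q' A' B'. orth_completion U Q' \<and> A' \<in> skew \<and> B' \<in> trailing_rows \<and>
    Q ** vstack A B = Q' ** vstack A' B' \<and>
    X = Q' ** matexp (hstack (vstack ((2 * \<beta>) *\<^sub>R A') B') (vstack (- transpose B') 0))
          ** vstack (mat 1) 0 ** matexp ((1 - 2 * \<beta>) *\<^sub>R A')"
  then obtain Q' A' B' where *: "orth_completion U Q'" "B' \<in> trailing_rows"
    and eq: "Q ** vstack A B = Q' ** vstack A' B'"
    and X: "X = Q' ** matexp (hstack (vstack ((2 * \<beta>) *\<^sub>R A') B') (vstack (- transpose B') 0))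
          ** vstack (mat 1) 0 ** matexp ((1 - 2 * \<beta>) *\<^sub>R A')"
    by blast
  show "X = Q ** matexp (hstack (vstack ((2 * \<beta>) *\<^sub>R A) B) (vstack (- transpose B) 0))
      ** vstack (mat 1) 0 ** matexp ((1 - 2 * \<beta>) *\<^sub>R A)"
    unfolding X stiefel_exp_closed[OF * eq] stiefel_exp_closed[OF assms(1,3) refl] ..
qed (use assms in blast)

lemma stiefel_phi_eq:
  fixes U :: "real^'p^'n"
  assumes "orth_completion U Q" "A \<in> skew" "B \<in> trailing_rows"
  shows "stiefel_phi U (Q ** vstack A B) =
    Q ** vstack (matexp A) B ** inv_sqrt (mat 1 + transpose B ** B)"
  unfolding stiefel_phi_def
proof (rule the_equality)
  fix X
  assume "\<exists>Q' A' B'. orth_completion U Q' \<and> A' \<in> skew \<and> B' \<in> trailing_rows \<and>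
    Q ** vstack A B = Q' ** vstack A' B' \<and>
    X = Q' ** vstack (matexp A') B' ** inv_sqrt (mat 1 + transpose B' ** B')"
  then obtain Q' A' B' where *: "orth_completion U Q'" "B' \<in> trailing_rows"
    and eq: "Q ** vstack A B = Q' ** vstack A' B'"
    and X: "X = Q' ** vstack (matexp A') B' ** inv_sqrt (mat 1 + transpose B' ** B')"
    by blast
  show "X = Q ** vstack (matexp A) B ** inv_sqrt (mat 1 + transpose B ** B)"
    unfolding X stiefel_phi_closed[OF * eq] stiefel_phi_closed[OF assms(1,3) refl] ..
qed (use assms in blast)

end

end

theory Submission
  imports Defs
begin

text \<open>
  Put \<open>A = U\<^sup>T\<xi>\<close> and \<open>V = \<xi> - U A\<close>. For a tangent vector \<open>\<xi>\<close> at \<open>U\<close> the matrix \<open>A\<close> is skew and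
  \<open>U\<^sup>T V = 0\<close>, and without the completion the retraction reads \<open>(U exp(A) + V) N(V)\<close>, where \<open>N(V)\<close> is the
  inverse square root of \<open>I + V\<^sup>T V\<close>. All three parts of the claim are read off from this form.

  \<^emph>\<open>Values in the Stiefel manifold.\<close> The first factor has the Gram matrix \<open>I + V\<^sup>T V\<close>, because
  \<open>exp(A)\<close> is orthogonal; the second factor normalizes it (\<open>stiefel_phi_in_stiefel\<close>).

  \<^emph>\<open>Smoothness.\<close> The formula makes sense for all pairs \<open>(U, \<xi>)\<close> of matrices, so it is its own smooth
  extension, once the matrix exponential and \<open>N\<close> are known to be smooth. Both are, locally, power series with scalar coefficients in a square matrix: the
  second one is the binomial series in \<open>X = I - (I + V\<^sup>T V)/c\<close>, where \<open>c\<close> is so large that the operator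
  norm of \<open>X\<close> is less than 1 (\<open>inv_sqrt_eq_matseries\<close>, \<open>gram_shift_estimates\<close>). Such a series is
  smooth inside its disc of convergence (\<open>Ck_on_matseries\<close>): the iterated directional
  derivatives of \<open>X\<^sup>n\<close> are bounded by \<open>C \<rho>\<^sup>n\<close> for every \<open>\<rho>\<close> above the operator norm of \<open>X\<close>, with \<open>C\<close>
  independent of \<open>n\<close>, locally uniformly in \<open>X\<close>, so that the series can be differentiated term by
  term as often as desired.

  \<^emph>\<open>Taylor terms.\<close> Let \<open>r(t) = N(tV)\<close>. Differentiating
  \<open>r(t)\<^sup>2 (I + t\<^sup>2 V\<^sup>T V) = I\<close> twice gives \<open>r(0) = I\<close>, \<open>r'(0) = 0\<close>, \<open>r''(0) = - V\<^sup>T V\<close>. Hence the retraction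
  along \<open>t\<xi>\<close> has the derivatives \<open>U A + V\<close> and \<open>U A\<^sup>2 - U V\<^sup>T V\<close> at \<open>t = 0\<close>. The Riemannian exponential
  along \<open>t\<xi>\<close> is \<open>exp(tG) U exp(t(1 - 2\<beta>)A)\<close> with \<open>G U = 2\<beta> U A + V\<close> and \<open>G V = - U V\<^sup>T V\<close>; its derivatives at 0
  are \<open>U A + V\<close> and \<open>U A\<^sup>2 - U V\<^sup>T V + 2(1 - \<beta>) V A\<close>. The first ones agree for all \<open>\<beta>\<close>, the second
  ones for \<open>\<beta> = 1\<close>.
\<close>

section \<open>Calculus of continuously differentiable maps\<close>

lemma Ck_on_cong:
  assumes "open W" "\<And>x. x \<in> W \<Longrightarrow> f x = g x"
  shows "Ck_on k f W \<longleftrightarrow> Ck_on k g W"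
  using assms(2)
proof (induction k arbitrary: f g)
  case 0
  then show ?case by (simp cong: continuous_on_cong)
next
  case (Suc k)
  have fd: "frechet_derivative f (at x) = frechet_derivative g (at x)" if "x \<in> W" for x
    unfolding frechet_derivative_def
    by (metis Suc.prems assms(1) that has_derivative_transform_within_open)
  have "f differentiable_on W \<longleftrightarrow> g differentiable_on W"
    using Suc.prems
    unfolding differentiable_on_def differentiable_def
    by (metis (no_types, lifting) has_derivative_transform)
  then show ?case
    using Suc.IH[of "\<lambda>x. frechet_derivative f (at x) v" "\<lambda>x. frechet_derivative g (at x) v" for v]
    by (simp add: fd)
qed

lemma Ck_on_Suc_has_derivative:
  assumes "open W" "Ck_on (Suc k) f W" "x \<in> W"
  shows "(f has_derivative frechet_derivative f (at x)) (at x)"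
  using assms by (metis Ck_on.simps(2) differentiable_on_eq_differentiable_at frechet_derivative_works)

text \<open>
  Certifies differentiability from an explicit derivative, so that \<open>frechet_derivative\<close>, which is defined
  by choice, need not be computed.
\<close>

lemma Ck_on_SucI:
  assumes "open W" "\<And>x. x \<in> W \<Longrightarrow> (f has_derivative f' x) (at x)"
    "\<And>v. Ck_on k (\<lambda>x. f' x v) W"
  shows "Ck_on (Suc k) f W"
proof -
  have fd: "frechet_derivative f (at x) = f' x" if "x \<in> W" for x
    using frechet_derivative_at[OF assms(2)[OF that]] by simp
  then have "Ck_on k (\<lambda>x. frechet_derivative f (at x) v) W" for v
    using assms(3)[of v]
      Ck_on_cong[OF assms(1), of "\<lambda>x. frechet_derivative f (at x) v" "\<lambda>x. f' x v" k]
    by (simp add: fd)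
  moreover have "f differentiable_on W"
    unfolding differentiable_on_def
    using assms(2) by (auto intro: differentiable_at_withinI differentiableI)
  ultimately show ?thesis by simp
qed

lemma Ck_on_Suc_mono:
  assumes "Ck_on (Suc k) f W"
  shows "Ck_on k f W"
  using assms
proof (induction k arbitrary: f)
  case 0
  then show ?case by (simp add: differentiable_imp_continuous_on)
next
  case (Suc k)
  from Suc.prems have "f differentiable_on W" "Ck_on (Suc k) (\<lambda>x. frechet_derivative f (at x) v) W"
    for v
    unfolding Ck_on.simps(2) by blast+
  then show ?case
    using Suc.IH by simp
qed

text \<open>
  The neighbourhoods may depend on the point. This lets a function be represented by a different power
  series near each point.
\<close>

lemma Ck_on_localI:
  assumes "\<And>x. x \<in> W \<Longrightarrow> \<exists>V. open V \<and> x \<in> V \<and> Ck_on k f V"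
  shows "Ck_on k f W"
  using assms
proof (induction k arbitrary: f)
  case 0
  show ?case
    unfolding Ck_on.simps
  proof (rule continuous_at_imp_continuous_on, rule ballI)
    fix x assume "x \<in> W"
    then obtain V where "open V" "x \<in> V" "Ck_on 0 f V" using 0 by blast
    then show "isCont f x"
      by (simp add: continuous_on_eq_continuous_at)
  qed
next
  case (Suc k)
  have "f differentiable_on W"
    unfolding differentiable_on_def
  proof
    fix x assume "x \<in> W"
    then obtain V where "open V" "x \<in> V" "Ck_on (Suc k) f V" using Suc.prems by blast
    then show "f differentiable (at x within W)"
      using differentiable_at_withinI[OF differentiableI[OF Ck_on_Suc_has_derivative]] by metis
  qed
  moreover have "Ck_on k (\<lambda>x. frechet_derivative f (at x) v) W" for v
  proof (rule Suc.IH)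
    fix x assume "x \<in> W"
    then obtain V where "open V" "x \<in> V" "Ck_on (Suc k) f V" using Suc.prems by blast
    then show "\<exists>V. open V \<and> x \<in> V \<and> Ck_on k (\<lambda>x. frechet_derivative f (at x) v) V"
      by (intro exI[of _ V]) simp
  qed
  ultimately show ?case by simp
qed

lemma Ck_on_const: "open W \<Longrightarrow> Ck_on k (\<lambda>x. c) W"
proof (induction k arbitrary: c)
  case (Suc k)
  show ?case
    by (rule Ck_on_SucI[where f' = "\<lambda>x v. 0"]) (simp_all add: Suc)
qed simp

lemma Ck_on_bounded_linear:
  assumes L: "bounded_linear L" and "open W" "Ck_on k f W"
  shows "Ck_on k (\<lambda>x. L (f x)) W"
  using assms(3)
proof (induction k arbitrary: f)
  case 0
  then show ?case by (simp add: bounded_linear.continuous_on[OF L])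
next
  case (Suc k)
  show ?case
  proof (rule Ck_on_SucI[OF assms(2), where f' = "\<lambda>x v. L (frechet_derivative f (at x) v)"])
    show "((\<lambda>x. L (f x)) has_derivative (\<lambda>v. L (frechet_derivative f (at x) v))) (at x)"
      if "x \<in> W" for x
      by (rule bounded_linear.has_derivative[OF L Ck_on_Suc_has_derivative[OF assms(2) Suc.prems that]])
    show "Ck_on k (\<lambda>x. L (frechet_derivative f (at x) v)) W" for v
      using Suc by simp
  qed
qed

lemma Ck_on_id: "open W \<Longrightarrow> Ck_on k (\<lambda>x. x) W"
proof (cases k)
  case (Suc m)
  assume W: "open W"
  show ?thesis
    unfolding Suc
    by (rule Ck_on_SucI[OF W, where f' = "\<lambda>x v. v"]) (simp_all add: Ck_on_const[OF W])
qed simp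

lemma Ck_on_add:
  assumes "open W" "Ck_on k f W" "Ck_on k g W"
  shows "Ck_on k (\<lambda>x. f x + g x) W"
  using assms(2,3)
proof (induction k arbitrary: f g)
  case 0
  then show ?case by (simp add: continuous_on_add)
next
  case (Suc k)
  show ?case
  proof (rule Ck_on_SucI[OF assms(1), where
      f' = "\<lambda>x v. frechet_derivative f (at x) v + frechet_derivative g (at x) v"])
    show "((\<lambda>x. f x + g x) has_derivative
        (\<lambda>v. frechet_derivative f (at x) v + frechet_derivative g (at x) v)) (at x)" if "x \<in> W" for x
      by (rule has_derivative_add[OF Ck_on_Suc_has_derivative[OF assms(1) Suc.prems(1) that]
            Ck_on_Suc_has_derivative[OF assms(1) Suc.prems(2) that]])
    show "Ck_on k (\<lambda>x. frechet_derivative f (at x) v + frechet_derivative g (at x) v) W" for v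
      using Suc by simp
  qed
qed

lemma Ck_on_sum:
  assumes "open W" "\<And>i. i \<in> I \<Longrightarrow> Ck_on k (f i) W"
  shows "Ck_on k (\<lambda>x. \<Sum>i\<in>I. f i x) W"
  using assms(2)
  by (induction I rule: infinite_finite_induct) (simp_all add: Ck_on_const Ck_on_add assms(1))

lemma Ck_on_bilinear:
  assumes B: "bounded_bilinear B" and "open W" "Ck_on k f W" "Ck_on k g W"
  shows "Ck_on k (\<lambda>x. B (f x) (g x)) W"
  using assms(3,4)
proof (induction k arbitrary: f g)
  case 0
  then show ?case by (simp add: bounded_bilinear.continuous_on[OF B])
next
  case (Suc k)
  show ?case
  proof (rule Ck_on_SucI[OF assms(2), where
      f' = "\<lambda>x v. B (f x) (frechet_derivative g (at x) v) + B (frechet_derivative f (at x) v) (g x)"])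
    show "((\<lambda>x. B (f x) (g x)) has_derivative
        (\<lambda>v. B (f x) (frechet_derivative g (at x) v) + B (frechet_derivative f (at x) v) (g x))) (at x)"
      if "x \<in> W" for x
      by (rule bounded_bilinear.FDERIV[OF B Ck_on_Suc_has_derivative[OF assms(2) Suc.prems(1) that]
            Ck_on_Suc_has_derivative[OF assms(2) Suc.prems(2) that]])
    show "Ck_on k (\<lambda>x. B (f x) (frechet_derivative g (at x) v)
        + B (frechet_derivative f (at x) v) (g x)) W" for v
    proof (intro Ck_on_add Suc.IH assms(2))
      show "Ck_on k f W" "Ck_on k g W"
        using Suc.prems by (blast intro: Ck_on_Suc_mono)+
      show "Ck_on k (\<lambda>x. frechet_derivative g (at x) v) W"
        "Ck_on k (\<lambda>x. frechet_derivative f (at x) v) W"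
        using Suc.prems by simp_all
    qed
  qed
qed

text \<open>
  By the chain rule a directional derivative of the composite is
  \<open>\<Sum>b. (Df(x)v \<bullet> b) Dg(f x) b\<close> over the basis vectors \<open>b\<close>: products of derivatives of \<open>f\<close> with composites of
  derivatives of \<open>g\<close>, both with one degree of smoothness less.
\<close>

lemma Ck_on_compose:
  assumes "open W" "open V" "f ` W \<subseteq> V" "Ck_on k f W" "Ck_on k g V"
  shows "Ck_on k (\<lambda>x. g (f x)) W"
  using assms(4,5)
proof (induction k arbitrary: g)
  case 0
  then show ?case
    using assms(3) by (auto intro: continuous_on_compose2)
next
  case (Suc k)
  show ?case
  proof (rule Ck_on_SucI[OF assms(1), where f' = "\<lambda>x v. \<Sum>b\<in>Basis.
      (frechet_derivative f (at x) v \<bullet> b) *\<^sub>R frechet_derivative g (at (f x)) b"])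
    fix x assume "x \<in> W"
    then have f: "(f has_derivative frechet_derivative f (at x)) (at x)"
      and g: "(g has_derivative frechet_derivative g (at (f x))) (at (f x))"
      using assms(3) by (auto intro!: Ck_on_Suc_has_derivative Suc.prems assms(1,2))
    have rep: "frechet_derivative g (at (f x)) w = (\<Sum>b\<in>Basis. (w \<bullet> b) *\<^sub>R frechet_derivative g (at (f x)) b)" for w
    proof -
      have l: "linear (frechet_derivative g (at (f x)))"
        using g by (simp add: has_derivative_linear)
      have "frechet_derivative g (at (f x)) w = frechet_derivative g (at (f x)) (\<Sum>b\<in>Basis. (w \<bullet> b) *\<^sub>R b)"
        by (simp add: euclidean_representation)
      then show ?thesis
        by (simp add: linear_sum[OF l] linear_scale[OF l])
    qed
    show "((\<lambda>x. g (f x)) has_derivative (\<lambda>v. \<Sum>b\<in>Basis.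
        (frechet_derivative f (at x) v \<bullet> b) *\<^sub>R frechet_derivative g (at (f x)) b)) (at x)"
      by (rule has_derivative_eq_rhs[OF has_derivative_compose[OF f g]]) (rule ext, rule rep)
  next
    fix v
    have f: "Ck_on k f W"
      using Suc.prems by (rule_tac Ck_on_Suc_mono)
    have "Ck_on k (\<lambda>x. (frechet_derivative f (at x) v \<bullet> b) *\<^sub>R frechet_derivative g (at (f x)) b) W" for b
    proof (rule Ck_on_bilinear[OF bounded_bilinear_scaleR assms(1)])
      show "Ck_on k (\<lambda>x. frechet_derivative f (at x) v \<bullet> b) W"
        using Suc.prems by (intro Ck_on_bounded_linear[OF bounded_linear_inner_left assms(1)]) auto
      show "Ck_on k (\<lambda>x. frechet_derivative g (at (f x)) b) W"
        using Suc.IH[OF f, of "\<lambda>y. frechet_derivative g (at y) b"] Suc.prems by simp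
    qed
    then show "Ck_on k (\<lambda>x. \<Sum>b\<in>Basis.
        (frechet_derivative f (at x) v \<bullet> b) *\<^sub>R frechet_derivative g (at (f x)) b) W"
      by (intro Ck_on_sum assms(1))
  qed
qed

section \<open>Series of maps with geometrically bounded derivatives\<close>

text \<open>
  The hypothesis under which \<open>\<Sum>n. a n *\<^sub>R g n x\<close> may be differentiated \<open>k\<close> times term by term when
  \<open>\<Sum>n. a n * \<rho>\<^sup>n\<close> converges absolutely. The constant \<open>C\<close> may depend on the directions of
  differentiation, but neither on \<open>n\<close> nor on the point. The recursion follows that of \<open>Ck_on\<close>.
\<close>

primrec geometric_Ck ::
    "nat \<Rightarrow> real \<Rightarrow> 'a::euclidean_space set \<Rightarrow> (nat \<Rightarrow> 'a \<Rightarrow> 'b::euclidean_space) \<Rightarrow> bool"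
  where
    "geometric_Ck 0 \<rho> W g \<longleftrightarrow> (\<forall>n. continuous_on W (g n)) \<and>
       (\<exists>C. \<forall>n. \<forall>x\<in>W. norm (g n x) \<le> C * \<rho> ^ n)"
  | "geometric_Ck (Suc k) \<rho> W g \<longleftrightarrow> (\<forall>n. g n differentiable_on W) \<and>
       (\<exists>C. \<forall>n. \<forall>x\<in>W. norm (g n x) \<le> C * \<rho> ^ n) \<and>
       (\<forall>v. geometric_Ck k \<rho> W (\<lambda>n x. frechet_derivative (g n) (at x) v))"

lemma geometric_Ck_bound:
  assumes "geometric_Ck k \<rho> W g"
  obtains C where "C \<ge> 0" "\<And>n x. x \<in> W \<Longrightarrow> norm (g n x) \<le> C * \<rho> ^ n"
proof -
  have "\<exists>C. \<forall>n. \<forall>x\<in>W. norm (g n x) \<le> C * \<rho> ^ n"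
    using assms by (cases k) auto
  then obtain C where C: "\<And>n x. x \<in> W \<Longrightarrow> norm (g n x) \<le> C * \<rho> ^ n"
    by blast
  have "C \<ge> 0" if "x \<in> W" for x
    using order_trans[OF norm_ge_zero C[OF that, of 0]] by simp
  then have "norm (g n x) \<le> max C 0 * \<rho> ^ n" if "x \<in> W" for n x
    using C[OF that] that by (simp add: max_absorb1)
  then show thesis using that[of "max C 0"] by simp
qed

lemma geometric_Ck_cong:
  assumes "open W" "\<And>n x. x \<in> W \<Longrightarrow> f n x = g n x"
  shows "geometric_Ck k \<rho> W f \<longleftrightarrow> geometric_Ck k \<rho> W g"
  using assms(2)
proof (induction k arbitrary: f g)
  case 0
  then show ?case by (simp cong: continuous_on_cong)
next
  case (Suc k)
  have fd: "frechet_derivative (f n) (at x) = frechet_derivative (g n) (at x)" if "x \<in> W" for n x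
    unfolding frechet_derivative_def
    by (metis Suc.prems assms(1) that has_derivative_transform_within_open)
  have "f n differentiable_on W \<longleftrightarrow> g n differentiable_on W" for n
    using Suc.prems unfolding differentiable_on_def differentiable_def
    by (metis (no_types, lifting) has_derivative_transform)
  then show ?case
    using Suc.IH[of "\<lambda>n x. frechet_derivative (f n) (at x) v"
        "\<lambda>n x. frechet_derivative (g n) (at x) v" for v]
    by (simp add: fd Suc.prems)
qed

lemma geometric_Ck_SucI:
  assumes "open W" "\<And>n x. x \<in> W \<Longrightarrow> (g n has_derivative g' n x) (at x)"
    "\<And>n x. x \<in> W \<Longrightarrow> norm (g n x) \<le> C * \<rho> ^ n"
    "\<And>v. geometric_Ck k \<rho> W (\<lambda>n x. g' n x v)"
  shows "geometric_Ck (Suc k) \<rho> W g"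
proof -
  have fd: "frechet_derivative (g n) (at x) = g' n x" if "x \<in> W" for n x
    using frechet_derivative_at[OF assms(2)[OF that]] by simp
  then have "geometric_Ck k \<rho> W (\<lambda>n x. frechet_derivative (g n) (at x) v)" for v
    using assms(4)[of v]
      geometric_Ck_cong[OF assms(1), of "\<lambda>n x. frechet_derivative (g n) (at x) v" "\<lambda>n x. g' n x v" k]
    by (simp add: fd)
  moreover have "g n differentiable_on W" for n
    unfolding differentiable_on_def
    using assms(2) by (auto intro: differentiable_at_withinI differentiableI)
  moreover have "\<exists>C. \<forall>n. \<forall>x\<in>W. norm (g n x) \<le> C * \<rho> ^ n"
    using assms(3) by blast
  ultimately show ?thesis by simp
qed

lemma geometric_Ck_Suc_has_derivative:
  assumes "open W" "geometric_Ck (Suc k) \<rho> W g" "x \<in> W"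
  shows "(g n has_derivative frechet_derivative (g n) (at x)) (at x)"
  using assms
  by (metis geometric_Ck.simps(2) differentiable_on_eq_differentiable_at frechet_derivative_works)

lemma geometric_Ck_Suc_mono:
  assumes "geometric_Ck (Suc k) \<rho> W g"
  shows "geometric_Ck k \<rho> W g"
  using assms
proof (induction k arbitrary: g)
  case 0
  then show ?case by (simp add: differentiable_imp_continuous_on)
next
  case (Suc k)
  from Suc.prems have "\<And>n. g n differentiable_on W"
    "\<exists>C. \<forall>n. \<forall>x\<in>W. norm (g n x) \<le> C * \<rho> ^ n"
    "\<And>v. geometric_Ck (Suc k) \<rho> W (\<lambda>n x. frechet_derivative (g n) (at x) v)"
    unfolding geometric_Ck.simps(2) by blast+
  then show ?case
    using Suc.IH by simp
qed

lemma geometric_Ck_const: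
  assumes "open W" "\<And>n. norm (c n) \<le> C * \<rho> ^ n"
  shows "geometric_Ck k \<rho> W (\<lambda>n x. c n)"
  using assms(2)
proof (induction k arbitrary: c C)
  case (Suc k)
  show ?case
    by (rule geometric_Ck_SucI[OF assms(1), where g' = "\<lambda>n x v. 0" and C = C])
      (use Suc.IH[of "\<lambda>n. 0" 0] Suc.prems in simp_all)
next
  case 0
  then have "\<exists>C. \<forall>n. \<forall>x\<in>W. norm (c n) \<le> C * \<rho> ^ n" by blast
  then show ?case by simp
qed

lemma geometric_Ck_shift:
  assumes "geometric_Ck k \<rho> W g"
  shows "geometric_Ck k \<rho> W (\<lambda>n. g (Suc n))"
proof -
  have C: "\<exists>C. \<forall>n. \<forall>x\<in>W. norm (g (Suc n) x) \<le> C * \<rho> ^ n"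
    if "\<exists>C. \<forall>n. \<forall>x\<in>W. norm (g n x) \<le> C * \<rho> ^ n" for g :: "nat \<Rightarrow> 'a \<Rightarrow> 'b"
  proof -
    from that obtain C where "\<forall>n. \<forall>x\<in>W. norm (g n x) \<le> C * \<rho> ^ n" by blast
    then have "\<forall>n. \<forall>x\<in>W. norm (g (Suc n) x) \<le> (C * \<rho>) * \<rho> ^ n"
      by (metis mult.assoc power_Suc)
    then show ?thesis by blast
  qed
  show ?thesis
    using assms
  proof (induction k arbitrary: g)
    case (Suc k)
    then show ?case
      using Suc.IH[of "\<lambda>n x. frechet_derivative (g n) (at x) v" for v] C[of g] by simp
  qed (simp add: C)
qed

lemma geometric_Ck_bounded_linear:
  assumes L: "bounded_linear L" and "open W" "geometric_Ck k \<rho> W g"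
  shows "geometric_Ck k \<rho> W (\<lambda>n x. L (g n x))"
  using assms(3)
proof (induction k arbitrary: g)
  case (0 g)
  obtain C where C: "C \<ge> 0" "\<And>n x. x \<in> W \<Longrightarrow> norm (g n x) \<le> C * \<rho> ^ n"
    using geometric_Ck_bound[OF 0] by blast
  have "norm (L (g n x)) \<le> (onorm L * C) * \<rho> ^ n" if "x \<in> W" for n x
    using onorm[OF L, of "g n x"] mult_left_mono[OF C(2)[OF that] onorm_pos_le[OF L]]
    by (simp add: mult.assoc) (meson order_trans)
  then have "\<exists>C. \<forall>n. \<forall>x\<in>W. norm (L (g n x)) \<le> C * \<rho> ^ n"
    by blast
  then show ?case
    using 0 by (simp add: bounded_linear.continuous_on[OF L])
next
  case (Suc k g)
  obtain C where C: "C \<ge> 0" "\<And>n x. x \<in> W \<Longrightarrow> norm (g n x) \<le> C * \<rho> ^ n"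
    using geometric_Ck_bound[OF Suc.prems] by blast
  have "norm (L (g n x)) \<le> (onorm L * C) * \<rho> ^ n" if "x \<in> W" for n x
    using onorm[OF L, of "g n x"] mult_left_mono[OF C(2)[OF that] onorm_pos_le[OF L]]
    by (simp add: mult.assoc) (meson order_trans)
  then show ?case
  proof (rule geometric_Ck_SucI[OF assms(2), rotated])
    show "((\<lambda>x. L (g n x)) has_derivative (\<lambda>v. L (frechet_derivative (g n) (at x) v))) (at x)"
      if "x \<in> W" for n x
      by (rule bounded_linear.has_derivative[OF L
            geometric_Ck_Suc_has_derivative[OF assms(2) Suc.prems that]])
    show "geometric_Ck k \<rho> W (\<lambda>n x. L (frechet_derivative (g n) (at x) v))" for v
      using Suc by simp
  qed
qed

lemma geometric_Ck_add:
  assumes "open W" "geometric_Ck k \<rho> W f" "geometric_Ck k \<rho> W g"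
  shows "geometric_Ck k \<rho> W (\<lambda>n x. f n x + g n x)"
  using assms(2,3)
proof (induction k arbitrary: f g)
  case (0 f g)
  obtain C D where C: "\<And>n x. x \<in> W \<Longrightarrow> norm (f n x) \<le> C * \<rho> ^ n"
    and D: "\<And>n x. x \<in> W \<Longrightarrow> norm (g n x) \<le> D * \<rho> ^ n"
    using geometric_Ck_bound[OF 0(1)] geometric_Ck_bound[OF 0(2)] by metis
  have "norm (f n x + g n x) \<le> (C + D) * \<rho> ^ n" if "x \<in> W" for n x
    using norm_triangle_mono[OF C[OF that] D[OF that]] by (simp add: distrib_right)
  then have "\<exists>C. \<forall>n. \<forall>x\<in>W. norm (f n x + g n x) \<le> C * \<rho> ^ n"
    by blast
  then show ?case
    using 0 by (simp add: continuous_on_add)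
next
  case (Suc k f g)
  obtain C D where C: "\<And>n x. x \<in> W \<Longrightarrow> norm (f n x) \<le> C * \<rho> ^ n"
    and D: "\<And>n x. x \<in> W \<Longrightarrow> norm (g n x) \<le> D * \<rho> ^ n"
    using geometric_Ck_bound[OF Suc.prems(1)] geometric_Ck_bound[OF Suc.prems(2)] by metis
  have "norm (f n x + g n x) \<le> (C + D) * \<rho> ^ n" if "x \<in> W" for n x
    using norm_triangle_mono[OF C[OF that] D[OF that]] by (simp add: distrib_right)
  then show ?case
  proof (rule geometric_Ck_SucI[OF assms(1), rotated])
    show "((\<lambda>x. f n x + g n x) has_derivative (\<lambda>v. frechet_derivative (f n) (at x) v
        + frechet_derivative (g n) (at x) v)) (at x)" if "x \<in> W" for n x
      by (rule has_derivative_add[OF geometric_Ck_Suc_has_derivative[OF assms(1) Suc.prems(1) that]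
            geometric_Ck_Suc_has_derivative[OF assms(1) Suc.prems(2) that]])
    show "geometric_Ck k \<rho> W (\<lambda>n x. frechet_derivative (f n) (at x) v
        + frechet_derivative (g n) (at x) v)" for v
      using Suc by simp
  qed
qed

text \<open>
  Meant for \<open>h (n + 1) x = x\<^sup>n\<close>, but in a form that is closed under differentiation: by the product rule
  \<open>D\<^sub>v h (n + 1) = B x (D\<^sub>v h n) + (B v (h n) + D\<^sub>v w n)\<close>, which is the same recursion with another
  inhomogeneity. A bound \<open>w n = O(\<rho>\<^sup>n)\<close> is passed on to \<open>h\<close> because \<open>r < \<rho>\<close>. Starting from \<open>h 0 = 0\<close>
  rather than from \<open>x\<^sup>0\<close> makes the initial value of every derivative 0 again.
\<close>

lemma geometric_Ck_recursion:
  assumes B: "bounded_bilinear B" and "open W"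
    and r: "\<And>x y. x \<in> W \<Longrightarrow> norm (B x y) \<le> r * norm y" "0 \<le> r" "r < \<rho>"
    and h: "\<And>x. h 0 x = 0" "\<And>n x. h (Suc n) x = B x (h n x) + w n x"
    and w: "geometric_Ck k \<rho> W w"
  shows "geometric_Ck k \<rho> W h"
proof -
  have bound: "\<exists>C. \<forall>n. \<forall>x\<in>W. norm (h n x) \<le> C * \<rho> ^ n"
    if h: "\<And>x. x \<in> W \<Longrightarrow> h 0 x = 0" "\<And>n x. x \<in> W \<Longrightarrow> h (Suc n) x = B x (h n x) + w n x"
      and w: "geometric_Ck k \<rho> W w" for h w and k :: nat
  proof -
    obtain D where D: "D \<ge> 0" "\<And>n x. x \<in> W \<Longrightarrow> norm (w n x) \<le> D * \<rho> ^ n"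
      using geometric_Ck_bound[OF w] by blast
    \<comment> \<open>A bound that the recursion reproduces.\<close>
    define C where "C = D / (\<rho> - r)"
    have C: "C \<ge> 0" "r * C + D = C * \<rho>"
      using D(1) r by (auto simp: C_def field_simps)
    have "norm (h n x) \<le> C * \<rho> ^ n" if x: "x \<in> W" for n x
    proof (induction n)
      case 0
      then show ?case using C by (simp add: h x)
    next
      case (Suc n)
      have "norm (h (Suc n) x) \<le> r * norm (h n x) + norm (w n x)"
        using norm_triangle_ineq[of "B x (h n x)" "w n x"] r(1)[OF x, of "h n x"] x by (simp add: h)
      also have "\<dots> \<le> r * (C * \<rho> ^ n) + D * \<rho> ^ n"
        by (intro add_mono mult_left_mono Suc D x r)
      also have "\<dots> = (r * C + D) * \<rho> ^ n"
        by (simp add: algebra_simps)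
      finally show ?case by (simp add: C)
    qed
    then show ?thesis by blast
  qed
  show ?thesis
    using h w
  proof (induction k arbitrary: h w)
    case (0 h w)
    note h0 = 0(1)
    have "continuous_on W (h n)" for n
    proof (induction n)
      case (Suc n)
      have "continuous_on W (\<lambda>x. B x (h n x))"
        by (rule bounded_bilinear.continuous_on[OF B continuous_on_id Suc])
      then have "continuous_on W (\<lambda>x. B x (h n x) + w n x)"
        using 0(3) by (simp add: continuous_on_add)
      then show ?case
        by (rule continuous_on_eq) (simp add: 0(2))
    next
      case 0
      show ?case
        by (rule continuous_on_eq[OF continuous_on_const[of W 0]]) (simp add: h0)
    qed
    then show ?case using bound[of h w 0] 0 by simp
  next
    case (Suc k h w)
    note h = Suc.prems(1,2) and w = Suc.prems(3)
    have der: "(h n has_derivative frechet_derivative (h n) (at x)) (at x) \<and>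
        (h (Suc n) has_derivative (\<lambda>v. (B x (frechet_derivative (h n) (at x) v) + B v (h n x))
          + frechet_derivative (w n) (at x) v)) (at x)" if x: "x \<in> W" for n x
    proof (induction n)
      case 0
      have h0: "h 0 = (\<lambda>x. 0)" by (auto simp: h)
      have "h (Suc 0) = w 0"
        using bounded_bilinear.zero_right[OF B] by (auto simp: h)
      then show ?case
        using geometric_Ck_Suc_has_derivative[OF assms(2) w x, of 0]
          bounded_bilinear.zero_right[OF B]
        by (simp add: h0 frechet_derivative_const)
    next
      case (Suc n)
      then have *: "(h (Suc n) has_derivative frechet_derivative (h (Suc n)) (at x)) (at x)"
        using frechet_derivative_at by force
      have "((\<lambda>x. B x (h (Suc n) x) + w (Suc n) x) has_derivative
        (\<lambda>v. (B x (frechet_derivative (h (Suc n)) (at x) v) + B v (h (Suc n) x))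
          + frechet_derivative (w (Suc n)) (at x) v)) (at x)"
        by (rule has_derivative_add[OF bounded_bilinear.FDERIV[OF B has_derivative_ident *]
              geometric_Ck_Suc_has_derivative[OF assms(2) w x]])
      moreover have "h (Suc (Suc n)) = (\<lambda>x. B x (h (Suc n) x) + w (Suc n) x)"
        using h(2)[of "Suc n"] by blast
      ultimately show ?case
        using * by simp
    qed
    have fd: "frechet_derivative (h (Suc n)) (at x) v = (B x (frechet_derivative (h n) (at x) v)
        + B v (h n x)) + frechet_derivative (w n) (at x) v" if "x \<in> W" for n x v
      using fun_cong[OF frechet_derivative_at[OF conjunct2[OF der[OF that, of n]]], of v] by simp
    have hk: "geometric_Ck k \<rho> W h"
      using Suc.IH[OF h geometric_Ck_Suc_mono[OF w]] .
    have "geometric_Ck k \<rho> W (\<lambda>n x. frechet_derivative (h n) (at x) v)" for v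
    proof -
      \<comment> \<open>The recursion is required at all points, but the derivatives satisfy it
        only inside W; outside W the sequence D is defined by the recursion.\<close>
      define D where "D = (\<lambda>n x. if x \<in> W then frechet_derivative (h n) (at x) v else
         rec_nat 0 (\<lambda>n y. B x y + (B v (h n x) + frechet_derivative (w n) (at x) v)) n)"
      have h0: "h 0 = (\<lambda>x. 0)" by (auto simp: h)
      have "geometric_Ck k \<rho> W D"
      proof (rule Suc.IH)
        show "D 0 x = 0" for x by (simp add: D_def h0 frechet_derivative_const)
        show "D (Suc n) x = B x (D n x) + (B v (h n x) + frechet_derivative (w n) (at x) v)" for n x
          by (cases "x \<in> W") (simp_all only: D_def fd if_True if_False nat.rec add.assoc)
        show "geometric_Ck k \<rho> W (\<lambda>n x. B v (h n x) + frechet_derivative (w n) (at x) v)"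
        proof (rule geometric_Ck_add[OF assms(2)])
          show "geometric_Ck k \<rho> W (\<lambda>n x. B v (h n x))"
            by (rule geometric_Ck_bounded_linear[OF bounded_bilinear.bounded_linear_right[OF B] assms(2) hk])
          show "geometric_Ck k \<rho> W (\<lambda>n x. frechet_derivative (w n) (at x) v)"
            using w by simp
        qed
      qed
      then show ?thesis
        using geometric_Ck_cong[OF assms(2), of D "\<lambda>n x. frechet_derivative (h n) (at x) v"]
        by (simp add: D_def)
    qed
    moreover have "h n differentiable_on W" for n
      unfolding differentiable_on_def
      using der by (blast intro: differentiable_at_withinI differentiableI)
    ultimately show ?case
      using bound[OF _ _ w, of h] h by simp
  qed
qed

text \<open>
  The bounds on the derivatives in the finitely many basis directions dominate the operator norms of the
  derivatives of the terms, hence the differentiated series converges uniformly.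
\<close>

lemma Ck_on_series:
  assumes "open W" "convex W" "summable (\<lambda>n. \<bar>a n\<bar> * \<rho> ^ n)"
    and "geometric_Ck k \<rho> W g"
  shows "Ck_on k (\<lambda>x. \<Sum>n. a n *\<^sub>R g n x) W"
  using assms(4)
proof (induction k arbitrary: g)
  case (0 g)
  obtain C where C: "C \<ge> 0" "\<And>n x. x \<in> W \<Longrightarrow> norm (g n x) \<le> C * \<rho> ^ n"
    using geometric_Ck_bound[OF 0] by blast
  have lim: "uniform_limit W (\<lambda>n x. \<Sum>i<n. a i *\<^sub>R g i x) (\<lambda>x. \<Sum>i. a i *\<^sub>R g i x) sequentially"
  proof (rule Weierstrass_m_test)
    show "norm (a n *\<^sub>R g n x) \<le> C * (\<bar>a n\<bar> * \<rho> ^ n)" if "x \<in> W" for n x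
      using mult_left_mono[OF C(2)[OF that], of "\<bar>a n\<bar>" n] by (simp add: mult_ac)
    show "summable (\<lambda>n. C * (\<bar>a n\<bar> * \<rho> ^ n))"
      using assms(3) by (rule summable_mult)
  qed
  have "continuous_on W (\<lambda>x. \<Sum>i<n. a i *\<^sub>R g i x)" for n
  proof -
    have "continuous_on W (g i)" for i
      using 0 by simp
    then show ?thesis
      by (intro continuous_on_sum continuous_on_scaleR continuous_on_const)
  qed
  then have "continuous_on W (\<lambda>x. \<Sum>i. a i *\<^sub>R g i x)"
    by (intro uniform_limit_theorem[OF _ lim] always_eventually) simp_all
  then show ?case by simp
next
  case (Suc k g)
  define T where "T n x v = a n *\<^sub>R frechet_derivative (g n) (at x) v" for n x v
  have der: "(g n has_derivative frechet_derivative (g n) (at x)) (at x)" if "x \<in> W" for n x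
    using geometric_Ck_Suc_has_derivative[OF assms(1) Suc.prems that] .
  obtain C where C: "C \<ge> 0" "\<And>n x. x \<in> W \<Longrightarrow> norm (g n x) \<le> C * \<rho> ^ n"
    using geometric_Ck_bound[OF Suc.prems] by blast
  have gk: "geometric_Ck k \<rho> W (\<lambda>n x. frechet_derivative (g n) (at x) v)" for v
    using Suc.prems by simp
  have "\<forall>v. \<exists>D\<ge>0. \<forall>n. \<forall>x\<in>W. norm (frechet_derivative (g n) (at x) v) \<le> D * \<rho> ^ n"
  proof
    fix v
    from geometric_Ck_bound[OF gk[of v]] obtain D where
      "D \<ge> 0" "\<And>n x. x \<in> W \<Longrightarrow> norm (frechet_derivative (g n) (at x) v) \<le> D * \<rho> ^ n"
      by blast
    then show "\<exists>D\<ge>0. \<forall>n. \<forall>x\<in>W. norm (frechet_derivative (g n) (at x) v) \<le> D * \<rho> ^ n"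
      by (intro exI[of _ D]) simp
  qed
  from choice[OF this] obtain D where D: "\<And>v. D v \<ge> 0"
    "\<And>v n x. x \<in> W \<Longrightarrow> norm (frechet_derivative (g n) (at x) v) \<le> D v * \<rho> ^ n"
    by auto
  define K where "K = (\<Sum>b\<in>Basis. D b)"
  have K: "norm (T n x v) \<le> norm v * K * (\<bar>a n\<bar> * \<rho> ^ n)" if x: "x \<in> W" for n x v
  proof -
    have l: "linear (frechet_derivative (g n) (at x))"
      by (rule has_derivative_linear[OF der[OF x]])
    have "frechet_derivative (g n) (at x) v = frechet_derivative (g n) (at x) (\<Sum>b\<in>Basis. (v \<bullet> b) *\<^sub>R b)"
      by (simp add: euclidean_representation)
    also have "\<dots> = (\<Sum>b\<in>Basis. (v \<bullet> b) *\<^sub>R frechet_derivative (g n) (at x) b)"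
      by (simp add: linear_sum[OF l] linear_scale[OF l])
    also have "norm \<dots> \<le> (\<Sum>b\<in>Basis. norm v * (D b * \<rho> ^ n))"
      by (rule order_trans[OF norm_sum]) (auto intro!: sum_mono mult_mono D x simp: Basis_le_norm)
    also have "\<dots> = norm v * K * \<rho> ^ n"
      by (simp add: K_def sum_distrib_left sum_distrib_right mult.assoc)
    finally show ?thesis
      using mult_left_mono[of "norm (frechet_derivative (g n) (at x) v)" "norm v * K * \<rho> ^ n"
          "\<bar>a n\<bar>"]
      by (simp add: T_def mult_ac)
  qed
  have sumT: "summable (\<lambda>n. norm (T n x v))" if "x \<in> W" for x v
    by (rule summable_comparison_test'[where N = 0, OF summable_mult[OF assms(3), of "norm v * K"]])
      (use K[OF that] in simp)
  have sumG: "summable (\<lambda>n. a n *\<^sub>R g n x)" if "x \<in> W" for x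
  proof (rule summable_comparison_test'[where N = 0, OF summable_mult[OF assms(3), of C]])
    show "norm (a n *\<^sub>R g n x) \<le> C * (\<bar>a n\<bar> * \<rho> ^ n)" for n
      using mult_left_mono[OF C(2)[OF that], of "\<bar>a n\<bar>" n] by (simp add: mult_ac)
  qed
  have tail: "norm ((\<Sum>i<n. T i x v) - (\<Sum>i. T i x v))
      \<le> norm v * K * (\<Sum>i. \<bar>a (i + n)\<bar> * \<rho> ^ (i + n))" if "x \<in> W" for n x v
  proof -
    have s: "summable (\<lambda>i. norm (T (i + n) x v))"
      using sumT[OF that] by (simp add: summable_iff_shift[of "\<lambda>i. norm (T i x v)" n])
    have s2: "summable (\<lambda>i. \<bar>a (i + n)\<bar> * \<rho> ^ (i + n))"
      using assms(3) by (subst summable_iff_shift[of "\<lambda>i. \<bar>a i\<bar> * \<rho> ^ i" n])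
    have "norm ((\<Sum>i<n. T i x v) - (\<Sum>i. T i x v)) = norm (\<Sum>i. T (i + n) x v)"
      using suminf_minus_initial_segment[OF summable_norm_cancel[OF sumT[OF that]], where k = n]
      by (simp add: norm_minus_commute)
    also have "\<dots> \<le> (\<Sum>i. norm (T (i + n) x v))"
      by (rule summable_norm[OF s])
    also have "\<dots> \<le> (\<Sum>i. norm v * K * (\<bar>a (i + n)\<bar> * \<rho> ^ (i + n)))"
      by (intro suminf_le s summable_mult s2 K that)
    also have "\<dots> = norm v * K * (\<Sum>i. \<bar>a (i + n)\<bar> * \<rho> ^ (i + n))"
      by (rule suminf_mult[OF s2])
    finally show ?thesis .
  qed
  show ?case
  proof (rule Ck_on_SucI[OF assms(1), where f' = "\<lambda>x v. \<Sum>n. T n x v"])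
    show "Ck_on k (\<lambda>x. \<Sum>n. T n x v) W" for v
      unfolding T_def by (rule Suc.IH[OF gk])
    fix x assume x: "x \<in> W"
    have "\<exists>G. \<forall>x\<in>W. (\<lambda>n. a n *\<^sub>R g n x) sums (G x) \<and>
        (G has_derivative (\<lambda>v. \<Sum>n. T n x v)) (at x within W)"
    proof (rule has_derivative_series[of W "\<lambda>n x. a n *\<^sub>R g n x" T "\<lambda>x v. \<Sum>n. T n x v" x])
      show "convex W" "x \<in> W" "(\<lambda>n. a n *\<^sub>R g n x) sums (\<Sum>n. a n *\<^sub>R g n x)"
        using assms(2) x summable_sums[OF sumG[OF x]] by blast+
      show "((\<lambda>x. a n *\<^sub>R g n x) has_derivative T n x) (at x within W)" if "x \<in> W" for n x
      proof -
        have "T n x = (\<lambda>v. a n *\<^sub>R frechet_derivative (g n) (at x) v)"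
          by (rule ext) (rule T_def)
        then show ?thesis
          using has_derivative_scaleR_right[OF has_derivative_at_withinI[OF der[OF that, of n]], of "a n" W]
          by simp
      qed
      fix e :: real assume "e > 0"
      have "(\<lambda>n. K * (\<Sum>i. \<bar>a (i + n)\<bar> * \<rho> ^ (i + n))) \<longlonglongrightarrow> K * 0"
        by (rule tendsto_mult_left[OF suminf_exist_split2[OF assms(3)]])
      then have "\<forall>\<^sub>F n in sequentially. K * (\<Sum>i. \<bar>a (i + n)\<bar> * \<rho> ^ (i + n)) < e"
        using order_tendstoD(2)[of _ "K * 0" _ e] \<open>e > 0\<close> by simp
      then show "\<forall>\<^sub>F n in sequentially. \<forall>x\<in>W. \<forall>v.
          norm ((\<Sum>i<n. T i x v) - (\<Sum>n. T n x v)) \<le> e * norm v"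
      proof eventually_elim
        case (elim n)
        have "norm v * K * (\<Sum>i. \<bar>a (i + n)\<bar> * \<rho> ^ (i + n)) \<le> e * norm v" for v :: 'a
          using mult_left_mono[OF less_imp_le[OF elim], of "norm v"] by (simp add: mult_ac)
        then show ?case by (intro ballI allI order_trans[OF tail])
      qed
    qed
    then obtain G where G: "\<And>x. x \<in> W \<Longrightarrow> (\<Sum>n. a n *\<^sub>R g n x) = G x"
      "(G has_derivative (\<lambda>v. \<Sum>n. T n x v)) (at x within W)"
      using x by (auto dest: sums_unique[symmetric])
    have "(G has_derivative (\<lambda>v. \<Sum>n. T n x v)) (at x)"
      using G(2) at_within_open[OF x assms(1)] by simp
    then show "((\<lambda>x. \<Sum>n. a n *\<^sub>R g n x) has_derivative (\<lambda>v. \<Sum>n. T n x v)) (at x)"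
      by (rule has_derivative_transform_within_open[OF _ assms(1) x]) (simp add: G(1))
  qed
qed

section \<open>Power series in a square matrix\<close>

lemma bounded_bilinear_matrix_mult:
  "bounded_bilinear ((**) :: real^'k^'m \<Rightarrow> real^'l^'k \<Rightarrow> real^'l^'m)"
  by (simp add: bilinear_conv_bounded_bilinear[symmetric] bilinear_def linear_iff
      matrix_mult_linear matrix_mult_scaleR)

lemma bounded_linear_transpose: "bounded_linear (transpose :: real^'k^'m \<Rightarrow> real^'m^'k)"
  by (simp add: linear_conv_bounded_linear[symmetric] linear_iff transpose_def vec_eq_iff)

lemma norm_transpose: "norm (transpose X) = norm (X :: real^'k^'m)"
proof -
  have "inner (transpose X) (transpose X) = inner X X"
    by (simp add: inner_vec_def transpose_def) (rule sum.swap)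
  then show ?thesis by (simp add: norm_eq_sqrt_inner)
qed

lemma onorm_matrix_le_norm: "onorm ((*v) X) \<le> norm (X :: real^'k^'m)"
proof (rule onorm_le)
  fix y :: "real^'k"
  have "\<bar>(X *v y) $ i\<bar> \<le> norm (X $ i) * norm y" for i
    using Cauchy_Schwarz_ineq2[of "X $ i" y] by (simp add: matrix_vector_mul_component)
  then have "norm (X *v y) \<le> L2_set (\<lambda>i. norm (X $ i) * norm y) UNIV"
    unfolding norm_vec_def[of "X *v y"] by (intro L2_set_mono) simp_all
  also have "\<dots> = norm X * norm y"
    by (simp add: norm_vec_def[of X] L2_set_left_distrib)
  finally show "norm (X *v y) \<le> norm X * norm y" .
qed

text \<open>
  The operator norm on the left factor is essential: the norm on matrices is the Frobenius norm, in which
  a symmetric matrix with spectrum in \<open>[0, 1)\<close> may have norm greater than 1.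
\<close>

lemma norm_matrix_mult_le:
  fixes X :: "real^'k^'m" and Y :: "real^'l^'k"
  shows "norm (X ** Y) \<le> onorm ((*v) X) * norm Y"
proof -
  have "transpose (X ** Y) $ j = X *v (transpose Y $ j)" for j
    by (simp add: vec_eq_iff transpose_def matrix_matrix_mult_def matrix_vector_mult_def)
  moreover have "norm (X *v y) \<le> norm y * onorm ((*v) X)" for y
    using onorm[OF matrix_vector_mul_bounded_linear[of X], of y] by (subst mult.commute)
  ultimately have "norm (transpose (X ** Y)) \<le> L2_set (\<lambda>j. norm (transpose Y $ j) * onorm ((*v) X)) UNIV"
    unfolding norm_vec_def[of "transpose (X ** Y)"]
    by (intro L2_set_mono) simp_all
  also have "\<dots> = norm (transpose Y) * onorm ((*v) X)"
    by (simp add: norm_vec_def[of "transpose Y"] L2_set_left_distrib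
        onorm_pos_le[OF matrix_vector_mul_bounded_linear])
  finally show ?thesis by (simp add: norm_transpose mult.commute)
qed

lemma onorm_matrix_ball:
  fixes X Y :: "real^'k^'m"
  assumes "Y \<in> ball X e"
  shows "onorm ((*v) Y) < onorm ((*v) X) + e"
proof -
  have "(*v) Y = (\<lambda>y. X *v y + (Y - X) *v y)"
    by (simp add: fun_eq_iff matrix_vector_mult_diff_rdistrib)
  then have "onorm ((*v) Y) \<le> onorm ((*v) X) + onorm ((*v) (Y - X))"
    using onorm_triangle[OF matrix_vector_mul_bounded_linear matrix_vector_mul_bounded_linear, of X "Y - X"]
    by simp
  also have "\<dots> < onorm ((*v) X) + e"
    using onorm_matrix_le_norm[of "Y - X"] assms by (simp add: dist_norm norm_minus_commute)
  finally show ?thesis .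
qed

lemma open_onorm_matrix_less: "open {X :: real^'k^'m. onorm ((*v) X) < \<rho>}"
proof (rule openI)
  fix X :: "real^'k^'m"
  assume X: "X \<in> {X. onorm ((*v) X) < \<rho>}"
  show "\<exists>e>0. ball X e \<subseteq> {X. onorm ((*v) X) < \<rho>}"
  proof (intro exI conjI subsetI)
    show "0 < \<rho> - onorm ((*v) X)" using X by simp
    show "Y \<in> {X. onorm ((*v) X) < \<rho>}" if "Y \<in> ball X (\<rho> - onorm ((*v) X))" for Y
      using onorm_matrix_ball[OF that] by simp
  qed
qed

definition matpow :: "real^'m^'m \<Rightarrow> nat \<Rightarrow> real^'m^'m"
  where "matpow X k = ((**) X ^^ k) (mat 1)"

definition matseries :: "(nat \<Rightarrow> real) \<Rightarrow> real^'m^'m \<Rightarrow> real^'m^'m"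
  where "matseries a X = (\<Sum>k. a k *\<^sub>R matpow X k)"

lemma matexp_eq_matseries: "matexp X = matseries (\<lambda>k. 1 / fact k) X"
  by (simp add: matexp_def matseries_def matpow_def)

lemma matpow_0 [simp]: "matpow X 0 = mat 1"
  and matpow_Suc: "matpow X (Suc k) = X ** matpow X k"
  by (simp_all add: matpow_def)

lemma matpow_commute: "Y ** X = X ** Y \<Longrightarrow> Y ** matpow X k = matpow X k ** Y"
proof (induction k)
  case (Suc k)
  have "Y ** (X ** matpow X k) = X ** (Y ** matpow X k)"
    by (simp add: matrix_mul_assoc Suc.prems)
  then show ?case by (simp add: matpow_Suc Suc matrix_mul_assoc)
qed simp

lemma matpow_add: "matpow X (k + l) = matpow X k ** matpow X l"
  by (induction k) (simp_all add: matpow_Suc matrix_mul_assoc)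

lemma matpow_scaleR: "matpow (t *\<^sub>R X) k = t ^ k *\<^sub>R matpow X k"
  by (induction k) (simp_all add: matpow_Suc matrix_mult_scaleR)

lemma transpose_matpow: "transpose (matpow X k) = matpow (transpose X) k"
proof (induction k)
  case (Suc k)
  have "transpose (matpow X (Suc k)) = matpow (transpose X) k ** transpose X"
    by (simp add: matpow_Suc matrix_transpose_mul Suc)
  then show ?case by (simp add: matpow_Suc matpow_commute)
qed simp

lemma norm_matpow_le:
  "norm (matpow X k) \<le> norm (mat 1 :: real^'m^'m) * onorm ((*v) X) ^ k" for X :: "real^'m^'m"
proof (induction k)
  case (Suc k)
  have "norm (matpow X (Suc k)) \<le> onorm ((*v) X) * norm (matpow X k)"
    by (simp add: matpow_Suc norm_matrix_mult_le)
  also have "\<dots> \<le> onorm ((*v) X) * (norm (mat 1 :: real^'m^'m) * onorm ((*v) X) ^ k)"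
    by (intro mult_left_mono Suc onorm_pos_le matrix_vector_mul_bounded_linear)
  finally show ?case by (simp add: mult_ac)
qed simp

lemma summable_norm_matseries:
  fixes X :: "real^'m^'m"
  assumes "summable (\<lambda>k. \<bar>a k\<bar> * onorm ((*v) X) ^ k)"
  shows "summable (\<lambda>k. norm (a k *\<^sub>R matpow X k))"
proof (rule summable_comparison_test'[OF summable_mult[OF assms, of "norm (mat 1 :: real^'m^'m)"], of 0])
  show "norm (norm (a k *\<^sub>R matpow X k)) \<le> norm (mat 1 :: real^'m^'m) * (\<bar>a k\<bar> * onorm ((*v) X) ^ k)" for k
    using mult_left_mono[OF norm_matpow_le[of X k], of "\<bar>a k\<bar>"] by (simp add: mult_ac)
qed

lemma sums_matseries:
  assumes "summable (\<lambda>k. \<bar>a k\<bar> * onorm ((*v) X) ^ k)"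
  shows "(\<lambda>k. a k *\<^sub>R matpow X k) sums matseries a X"
  unfolding matseries_def
  by (rule summable_sums[OF summable_norm_cancel[OF summable_norm_matseries[OF assms]]])

text \<open>
  On a small ball around \<open>X\<close> the operator norm stays below some \<open>r < \<rho>\<close>, and there the powers form a
  sequence as in \<open>geometric_Ck_recursion\<close>, with left multiplication as the bilinear map.
\<close>

lemma Ck_on_matseries:
  assumes "summable (\<lambda>n. \<bar>a n\<bar> * \<rho> ^ n)"
  shows "Ck_on k (matseries a) {X :: real^'m^'m. onorm ((*v) X) < \<rho>}"
proof (rule Ck_on_localI)
  fix X :: "real^'m^'m"
  assume "X \<in> {X. onorm ((*v) X) < \<rho>}"
  then have X: "onorm ((*v) X) < \<rho>" by simp
  define e where "e = (\<rho> - onorm ((*v) X)) / 2"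
  have r: "0 < e" "0 \<le> onorm ((*v) X) + e" "onorm ((*v) X) + e < \<rho>"
    using X onorm_pos_le[OF matrix_vector_mul_bounded_linear[of X]] by (simp_all add: e_def field_simps)
  \<comment> \<open>The powers, preceded by 0; they are created from 0 by an inhomogeneity that is
    concentrated at index 0.\<close>
  define h :: "nat \<Rightarrow> real^'m^'m \<Rightarrow> real^'m^'m"
    where "h n Y = (case n of 0 \<Rightarrow> 0 | Suc k \<Rightarrow> matpow Y k)" for n Y
  define w :: "nat \<Rightarrow> real^'m^'m" where "w n = (if n = 0 then mat 1 else 0)" for n
  have "geometric_Ck k \<rho> (ball X e) h"
  proof (rule geometric_Ck_recursion[OF bounded_bilinear_matrix_mult open_ball _ r(2,3)])
    show "norm (Y ** Z) \<le> (onorm ((*v) X) + e) * norm Z" if "Y \<in> ball X e" for Y Z :: "real^'m^'m"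
      by (rule order_trans[OF norm_matrix_mult_le mult_right_mono])
        (use onorm_matrix_ball[OF that] in simp_all)
    show "h 0 Y = 0" for Y by (simp add: h_def)
    show "h (Suc n) Y = Y ** h n Y + w n" for n Y
      by (cases n) (simp_all add: h_def w_def matpow_Suc)
    have "norm (w n) \<le> norm (mat 1 :: real^'m^'m) * \<rho> ^ n" for n
      using r by (simp add: w_def)
    then show "geometric_Ck k \<rho> (ball X e) (\<lambda>n Y. w n)"
      by (rule geometric_Ck_const[OF open_ball])
  qed
  then have "geometric_Ck k \<rho> (ball X e) (\<lambda>n. h (Suc n))"
    by (rule geometric_Ck_shift)
  then have "geometric_Ck k \<rho> (ball X e) (\<lambda>n Y. matpow Y n)"
    by (simp add: h_def[abs_def])
  then have "Ck_on k (\<lambda>Y. \<Sum>n. a n *\<^sub>R matpow Y n) (ball X e)"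
    by (rule Ck_on_series[OF open_ball convex_ball assms])
  then have "Ck_on k (matseries a) (ball X e)"
    by (simp add: matseries_def[abs_def])
  then show "\<exists>V. open V \<and> X \<in> V \<and> Ck_on k (matseries a) V"
    using r(1) by (intro exI[of _ "ball X e"]) simp
qed

lemma summable_matexp_coeff: "summable (\<lambda>k. \<bar>1 / fact k\<bar> * r ^ k)" for r :: real
  using summable_exp[of r] by (simp add: divide_inverse)

lemma Ck_on_matexp: "Ck_on k (matexp :: real^'m^'m \<Rightarrow> real^'m^'m) UNIV"
proof (rule Ck_on_localI)
  fix X :: "real^'m^'m"
  have "Ck_on k matexp {Y :: real^'m^'m. onorm ((*v) Y) < onorm ((*v) X) + 1}"
    using Ck_on_matseries[OF summable_matexp_coeff] by (simp add: matexp_eq_matseries[abs_def])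
  then show "\<exists>V. open V \<and> X \<in> V \<and> Ck_on k (matexp :: real^'m^'m \<Rightarrow> real^'m^'m) V"
    by (intro exI[of _ "{Y. onorm ((*v) Y) < onorm ((*v) X) + 1}"])
      (simp add: open_onorm_matrix_less)
qed

lemma sums_matrixI:
  fixes S :: "real^'k^'m"
  assumes "\<And>i j. (\<lambda>n. f n $ i $ j) sums (S $ i $ j)"
  shows "f sums S"
  unfolding sums_def
proof (rule vec_tendstoI, rule vec_tendstoI)
  show "(\<lambda>n. (\<Sum>k<n. f k) $ i $ j) \<longlonglongrightarrow> S $ i $ j" for i j
    using assms[of i j] by (simp add: sums_def)
qed

text \<open>
  Entry by entry, the product is a finite sum of Cauchy products of real series.
\<close>

lemma sums_matseries_mult:
  fixes X :: "real^'m^'m"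
  assumes a: "summable (\<lambda>k. \<bar>a k\<bar> * onorm ((*v) X) ^ k)"
    and b: "summable (\<lambda>k. \<bar>b k\<bar> * onorm ((*v) X) ^ k)"
  shows "(\<lambda>n. (\<Sum>k\<le>n. a k * b (n - k)) *\<^sub>R matpow X n) sums (matseries a X ** matseries b X)"
proof (rule sums_matrixI)
  fix i j
  have entry: "(\<lambda>k. c k * matpow X k $ i $ j) sums (matseries c X $ i $ j)"
    "summable (\<lambda>k. norm (c k * matpow X k $ i $ j))"
    if c: "summable (\<lambda>k. \<bar>c k\<bar> * onorm ((*v) X) ^ k)" for c i j
  proof -
    have L: "bounded_linear (\<lambda>Y :: real^'m^'m. Y $ i $ j)"
      using bounded_linear_compose[OF bounded_linear_vec_nth bounded_linear_vec_nth] by blast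
    show "(\<lambda>k. c k * matpow X k $ i $ j) sums (matseries c X $ i $ j)"
      using bounded_linear.sums[OF L sums_matseries[OF c]] by simp
    show "summable (\<lambda>k. norm (c k * matpow X k $ i $ j))"
    proof (rule summable_comparison_test'[OF summable_norm_matseries[OF c], of 0])
      show "norm (norm (c k * matpow X k $ i $ j)) \<le> norm (c k *\<^sub>R matpow X k)" for k
        using component_le_norm_cart[of "matpow X k $ i" j] Finite_Cartesian_Product.norm_nth_le[of "matpow X k" i]
        by (simp add: abs_mult mult_left_mono)
    qed
  qed
  have "(\<lambda>n. \<Sum>l\<in>UNIV. \<Sum>k\<le>n. (a k * matpow X k $ i $ l) * (b (n - k) * matpow X (n - k) $ l $ j))
      sums (\<Sum>l\<in>UNIV. (matseries a X $ i $ l) * (matseries b X $ l $ j))"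
  proof (rule sums_sum)
    fix l
    show "(\<lambda>n. \<Sum>k\<le>n. (a k * matpow X k $ i $ l) * (b (n - k) * matpow X (n - k) $ l $ j))
        sums ((matseries a X $ i $ l) * (matseries b X $ l $ j))"
      using Cauchy_product_sums[OF entry(2)[OF a, of i l] entry(2)[OF b, of l j]]
        sums_unique[OF entry(1)[OF a, of i l]] sums_unique[OF entry(1)[OF b, of l j]] by simp
  qed
  moreover have "(\<Sum>l\<in>UNIV. \<Sum>k\<le>n. (a k * matpow X k $ i $ l) * (b (n - k) * matpow X (n - k) $ l $ j))
      = ((\<Sum>k\<le>n. a k * b (n - k)) *\<^sub>R matpow X n) $ i $ j" for n
  proof -
    have "(\<Sum>l\<in>UNIV. (a k * matpow X k $ i $ l) * (b (n - k) * matpow X (n - k) $ l $ j))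
        = (a k * b (n - k)) * matpow X n $ i $ j" if "k \<le> n" for k
    proof -
      have "matpow X n = matpow X k ** matpow X (n - k)"
        using that by (simp flip: matpow_add)
      then show ?thesis
        by (simp add: matrix_matrix_mult_def sum_distrib_left mult_ac)
    qed
    then have "(\<Sum>k\<le>n. \<Sum>l\<in>UNIV. (a k * matpow X k $ i $ l) * (b (n - k) * matpow X (n - k) $ l $ j))
        = (\<Sum>k\<le>n. a k * b (n - k)) * matpow X n $ i $ j"
      by (simp add: sum_distrib_right)
    then show ?thesis
      by (subst sum.swap) simp
  qed
  ultimately show "(\<lambda>n. ((\<Sum>k\<le>n. a k * b (n - k)) *\<^sub>R matpow X n) $ i $ j) sums
      ((matseries a X ** matseries b X) $ i $ j)"
    by (simp add: matrix_matrix_mult_def)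
qed

lemma transpose_matseries:
  assumes "summable (\<lambda>k. \<bar>a k\<bar> * onorm ((*v) X) ^ k)"
  shows "transpose (matseries a X) = matseries a (transpose X)"
  using sums_unique[OF bounded_linear.sums[OF bounded_linear_transpose sums_matseries[OF assms]]]
  by (simp add: matseries_def[of a "transpose X"] transpose_scalar transpose_matpow)

lemma matseries_commute:
  assumes "summable (\<lambda>k. \<bar>a k\<bar> * onorm ((*v) X) ^ k)" "Y ** X = X ** Y"
  shows "Y ** matseries a X = matseries a X ** Y"
proof -
  note B = bounded_bilinear_matrix_mult
  have "(\<lambda>k. Y ** (a k *\<^sub>R matpow X k)) sums (Y ** matseries a X)"
    by (rule bounded_linear.sums[OF bounded_bilinear.bounded_linear_right[OF B] sums_matseries[OF assms(1)]])
  moreover have "(\<lambda>k. (a k *\<^sub>R matpow X k) ** Y) sums (matseries a X ** Y)"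
    by (rule bounded_linear.sums[OF bounded_bilinear.bounded_linear_left[OF B] sums_matseries[OF assms(1)]])
  ultimately show ?thesis
    using sums_unique2 by (simp add: matrix_mult_scaleR matpow_commute[OF assms(2)])
qed

section \<open>The inverse square root of a positive definite matrix\<close>

text \<open>
  The coefficients of the binomial series of \<open>1 / sqrt (1 - x)\<close>.
\<close>

definition inv_sqrt_coeff :: "nat \<Rightarrow> real"
  where "inv_sqrt_coeff k = pochhammer (1 / 2) k / fact k"

lemma inv_sqrt_coeff_0: "inv_sqrt_coeff 0 = 1"
  by (simp add: inv_sqrt_coeff_def)

text \<open>
  The square of the binomial series of \<open>1 / sqrt (1 - x)\<close> is the geometric series; on coefficients this
  is the Vandermonde identity for rising factorials.
\<close>

lemma inv_sqrt_coeff_convolution: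
  "(\<Sum>k\<le>n. inv_sqrt_coeff k * inv_sqrt_coeff (n - k)) = 1"
proof -
  have "inv_sqrt_coeff k * inv_sqrt_coeff (n - k) =
      (of_nat (n choose k) * pochhammer (1 / 2) k * pochhammer (1 / 2) (n - k)) / fact n"
    if "k \<le> n" for k
    using that by (simp add: inv_sqrt_coeff_def binomial_fact)
  then have "(\<Sum>k\<le>n. inv_sqrt_coeff k * inv_sqrt_coeff (n - k)) =
      pochhammer (1 / 2 + 1 / 2) n / fact n"
    unfolding pochhammer_binomial_sum by (simp add: sum_divide_distrib)
  then show ?thesis by (simp flip: pochhammer_fact)
qed

text \<open>
  The coefficient \<open>k\<close> is one of the nonnegative summands of its convolution, which is 1.
\<close>

lemma inv_sqrt_coeff_bounds: "0 \<le> inv_sqrt_coeff k" "inv_sqrt_coeff k \<le> 1"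
proof -
  show pos: "0 \<le> inv_sqrt_coeff k" for k
    by (simp add: inv_sqrt_coeff_def pochhammer_pos less_imp_le)
  have "inv_sqrt_coeff k * inv_sqrt_coeff (k - k)
      \<le> (\<Sum>i\<le>k. inv_sqrt_coeff i * inv_sqrt_coeff (k - i))"
    by (rule member_le_sum) (simp_all add: pos)
  then show "inv_sqrt_coeff k \<le> 1"
    by (simp add: inv_sqrt_coeff_convolution inv_sqrt_coeff_0)
qed

lemma summable_inv_sqrt_coeff:
  assumes "0 \<le> r" "r < 1"
  shows "summable (\<lambda>k. \<bar>inv_sqrt_coeff k\<bar> * r ^ k)"
proof (rule summable_comparison_test'[OF summable_geometric[of r], of 0])
  show "norm r < 1" using assms by simp
  show "norm (\<bar>inv_sqrt_coeff k\<bar> * r ^ k) \<le> r ^ k" for k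
    using mult_right_mono[OF inv_sqrt_coeff_bounds(2), of "r ^ k" k] inv_sqrt_coeff_bounds(1)[of k] assms
    by (simp add: abs_mult)
qed

lemma inner_symmetric_matrix:
  fixes X :: "real^'m^'m"
  assumes "transpose X = X"
  shows "inner (X *v x) y = inner x (X *v y)"
  using dot_lmul_matrix[of x X y] transpose_matrix_vector[of X x] assms by simp

lemma matrix_inv_eqI:
  fixes A B :: "real^'m^'m"
  assumes "A ** B = mat 1" "B ** A = mat 1"
  shows "matrix_inv A = B"
proof -
  have "A ** matrix_inv A = mat 1 \<and> matrix_inv A ** A = mat 1"
    unfolding matrix_inv_def by (rule someI[of _ B]) (use assms in simp)
  then have "B ** (A ** matrix_inv A) = B" by simp
  then show ?thesis by (simp only: matrix_mul_assoc assms matrix_mul_lid)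
qed

text \<open>
  \<open>(S + T) (S - T) = 0\<close> when \<open>S\<close> and \<open>T\<close> commute, and \<open>S + T\<close> is positive definite, hence injective.
\<close>

lemma spd_sqrt_unique:
  fixes S T :: "real^'m^'m"
  assumes "spd S" "spd T" "S ** S = T ** T" "S ** T = T ** S"
  shows "S = T"
proof -
  have "(S - T) *v y = 0" for y
  proof (rule ccontr)
    assume nz: "(S - T) *v y \<noteq> 0"
    let ?z = "(S - T) *v y"
    have "(S + T) ** (S - T) = 0"
      by (simp add: matrix_mult_linear assms(3,4))
    then have "(S + T) *v ?z = 0"
      by (simp add: matrix_vector_mul_assoc)
    then have "inner ?z (S *v ?z) + inner ?z (T *v ?z) = 0"
      by (simp add: matrix_vector_mult_add_rdistrib flip: inner_add_right)
    moreover have "0 < inner ?z (S *v ?z)" "0 < inner ?z (T *v ?z)"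
      using assms(1,2) nz unfolding spd_def by blast+
    ultimately show False by simp
  qed
  then show ?thesis
    by (simp add: matrix_eq matrix_vector_mult_diff_rdistrib)
qed

text \<open>
  The square root of \<open>M\<close> is \<open>T = R M\<close>, the inverse of \<open>R\<close>. Any other positive definite root \<open>S\<close> commutes with
  \<open>M = S\<^sup>2\<close>, thus by hypothesis with \<open>R\<close>, thus with \<open>T\<close>, and equals \<open>T\<close> by \<open>spd_sqrt_unique\<close>.
\<close>

lemma inv_sqrt_eqI:
  fixes M R :: "real^'m^'m"
  assumes R: "spd R" and RRM: "R ** R ** M = mat 1"
    and comm: "\<And>S. S ** M = M ** S \<Longrightarrow> S ** R = R ** S"
  shows "inv_sqrt M = R"
proof -
  define T where "T = R ** M"
  have RT: "R ** T = mat 1" by (simp add: T_def matrix_mul_assoc RRM)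
  then have TR: "T ** R = mat 1" using matrix_left_right_inverse by blast
  have RM: "R ** M = M ** R" using comm[of M] by simp
  have TT: "T ** T = M"
  proof -
    have "T ** T = T ** (R ** M)" by (simp add: T_def)
    then show ?thesis by (simp add: matrix_mul_assoc TR)
  qed
  have tT: "transpose T = T"
  proof -
    have "transpose R = R" using R by (simp add: spd_def)
    then have "transpose T ** R = mat 1"
      using arg_cong[OF RT, of transpose] by (simp add: matrix_transpose_mul)
    then have "transpose T ** (R ** T) = T" by (simp add: matrix_mul_assoc)
    then show ?thesis by (simp add: RT)
  qed
  have "spd T"
    unfolding spd_def
  proof (intro conjI allI impI tT)
    fix y :: "real^'m" assume "y \<noteq> 0"
    have y: "y = R *v (T *v y)" by (simp add: matrix_vector_mul_assoc RT)
    then have "T *v y \<noteq> 0" using \<open>y \<noteq> 0\<close> by (metis matrix_vector_mult_0_right)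
    then have "0 < inner (T *v y) (R *v (T *v y))" using R by (simp add: spd_def)
    then show "0 < inner y (T *v y)" by (simp add: inner_commute flip: y)
  qed
  have "(THE S. spd S \<and> S ** S = M) = T"
  proof (rule the_equality)
    show "spd T \<and> T ** T = M" by (simp add: TT \<open>spd T\<close>)
    fix S assume S: "spd S \<and> S ** S = M"
    then have SM: "S ** M = M ** S" by (metis matrix_mul_assoc)
    have "S ** T = (S ** R) ** M" by (simp add: T_def matrix_mul_assoc)
    also have "\<dots> = R ** (S ** M)" by (simp add: comm[OF SM] matrix_mul_assoc)
    also have "\<dots> = T ** S" by (simp add: SM T_def matrix_mul_assoc)
    finally have ST: "S ** T = T ** S" .
    have "S ** S = T ** T" using S TT by simp
    with S show "S = T" using spd_sqrt_unique[OF _ \<open>spd T\<close> _ ST] by blast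
  qed
  then show ?thesis
    unfolding inv_sqrt_def by (simp add: matrix_inv_eqI[OF TR RT])
qed

text \<open>
  Induction in steps of two: \<open>y\<^sup>T X\<^sup>k\<^sup>+\<^sup>2 y = (X y)\<^sup>T X\<^sup>k (X y)\<close>.
\<close>

lemma matpow_psd:
  fixes X :: "real^'m^'m"
  assumes "transpose X = X" "\<And>y. 0 \<le> inner y (X *v y)"
  shows "0 \<le> inner y (matpow X k *v y)"
proof (induction k arbitrary: y rule: induct_nat_012)
  case (ge2 k)
  have "matpow X (Suc (Suc k)) = X ** (matpow X k ** X)"
    by (simp add: matpow_Suc matpow_commute)
  then have "inner y (matpow X (Suc (Suc k)) *v y) = inner (X *v y) (matpow X k *v (X *v y))"
    using inner_symmetric_matrix[OF assms(1), of y "(matpow X k ** X) *v y"]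
    by (simp add: matrix_vector_mul_assoc)
  then show ?case using ge2 by simp
qed (use assms(2) in \<open>simp_all add: matpow_Suc\<close>)

lemma spd_matseries:
  fixes X :: "real^'m^'m"
  assumes X: "transpose X = X" "\<And>y. 0 \<le> inner y (X *v y)"
    and a: "summable (\<lambda>k. \<bar>a k\<bar> * onorm ((*v) X) ^ k)" "a 0 > 0" "\<And>k. 0 \<le> a k"
  shows "spd (matseries a X)"
  unfolding spd_def
proof (intro conjI allI impI)
  show "transpose (matseries a X) = matseries a X"
    using transpose_matseries[OF a(1)] X(1) by simp
  fix y :: "real^'m" assume "y \<noteq> 0"
  have L: "bounded_linear (\<lambda>Y :: real^'m^'m. inner y (Y *v y))"
    by (simp add: linear_conv_bounded_linear[symmetric] linear_iff matrix_vector_mult_add_rdistrib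
        inner_add_right scaleR_matrix_vector_assoc[symmetric])
  have s: "(\<lambda>k. a k * inner y (matpow X k *v y)) sums inner y (matseries a X *v y)"
    using bounded_linear.sums[OF L sums_matseries[OF a(1)]]
    by (simp add: scaleR_matrix_vector_assoc[symmetric])
  have "0 < a 0 * inner y (matpow X 0 *v y)"
    using a(2) \<open>y \<noteq> 0\<close> by simp
  also have "\<dots> \<le> (\<Sum>k. a k * inner y (matpow X k *v y))"
    using sum_le_suminf[OF sums_summable[OF s], of "{0}"] a(3) matpow_psd[OF X] by simp
  finally show "0 < inner y (matseries a X *v y)"
    using sums_unique[OF s] by simp
qed

lemma neumann_series:
  fixes X :: "real^'m^'m"
  assumes "onorm ((*v) X) < 1"
  shows "(mat 1 - X) ** matseries (\<lambda>k. 1) X = mat 1"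
proof -
  have "summable (\<lambda>k. \<bar>1\<bar> * onorm ((*v) X) ^ k)"
    using assms onorm_pos_le[OF matrix_vector_mul_bounded_linear[of X]] by (simp add: summable_geometric)
  from sums_matseries[OF this] have s: "(\<lambda>k. matpow X k) sums matseries (\<lambda>k. 1) X" by simp
  have "(\<lambda>k. matpow X (Suc k)) sums (X ** matseries (\<lambda>k. 1) X)"
    using bounded_linear.sums[OF bounded_bilinear.bounded_linear_right[OF bounded_bilinear_matrix_mult] s]
    by (simp add: matpow_Suc)
  then have "(\<lambda>k. matpow X k) sums (X ** matseries (\<lambda>k. 1) X + matpow X 0)"
    by (rule sums_Suc)
  from sums_unique2[OF s this] show ?thesis
    unfolding matrix_mult_linear matrix_mul_lid matpow_0 by (metis add_diff_cancel_left')
qed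

text \<open>
  The Cauchy product of the binomial series with itself is the Neumann series of \<open>I - X\<close>. Everything that
  commutes with \<open>X\<close> commutes with the series, as \<open>inv_sqrt_eqI\<close> requires.
\<close>

lemma inv_sqrt_eq_matseries:
  fixes X :: "real^'m^'m"
  assumes X: "transpose X = X" "\<And>y. 0 \<le> inner y (X *v y)" "onorm ((*v) X) < 1"
    and "0 < c" and M: "M = c *\<^sub>R (mat 1 - X)"
  defines "R \<equiv> (1 / sqrt c) *\<^sub>R matseries inv_sqrt_coeff X"
  shows "inv_sqrt M = R" "spd R" "R ** R ** M = mat 1"
proof -
  define F where "F = matseries inv_sqrt_coeff X"
  have R: "R = (1 / sqrt c) *\<^sub>R F" by (simp add: R_def F_def)
  have sm: "summable (\<lambda>k. \<bar>inv_sqrt_coeff k\<bar> * onorm ((*v) X) ^ k)"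
    by (rule summable_inv_sqrt_coeff)
      (use X(3) onorm_pos_le[OF matrix_vector_mul_bounded_linear[of X]] in simp_all)
  have F: "spd F"
    unfolding F_def
    by (rule spd_matseries[OF X(1,2) sm]) (simp_all add: inv_sqrt_coeff_0 inv_sqrt_coeff_bounds)
  have FF: "F ** F = matseries (\<lambda>k. 1) X"
    using sums_unique[OF sums_matseries_mult[OF sm sm]]
    by (simp add: F_def inv_sqrt_coeff_convolution matseries_def[of "\<lambda>k. 1"])
  have XFF: "(mat 1 - X) ** (F ** F) = mat 1"
    unfolding FF by (rule neumann_series[OF X(3)])
  then have "(F ** F) ** (mat 1 - X) = mat 1"
    using matrix_left_right_inverse by blast
  then show RRM: "R ** R ** M = mat 1"
    using \<open>0 < c\<close> by (simp add: R M matrix_mult_scaleR)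
  show spd: "spd R"
    using F \<open>0 < c\<close>
    by (simp add: spd_def R transpose_scalar scaleR_matrix_vector_assoc[symmetric])
  show "inv_sqrt M = R"
  proof (rule inv_sqrt_eqI[OF spd RRM])
    fix S :: "real^'m^'m" assume S: "S ** M = M ** S"
    have "c *\<^sub>R (S ** X) = c *\<^sub>R (X ** S)"
      using S by (simp add: M matrix_mult_scaleR matrix_mult_linear scaleR_diff_right)
    then have "S ** X = X ** S" using \<open>0 < c\<close> by simp
    then show "S ** R = R ** S"
      using matseries_commute[OF sm] by (simp add: R_def matrix_mult_scaleR)
  qed
qed

text \<open>
  The scaling that makes the binomial series converge. With \<open>M = I + V\<^sup>T V\<close> one has \<open>|My| \<le> (1 + K\<^sup>2) |y|\<close> and
  \<open>|y|\<^sup>2 \<le> y\<^sup>T M y\<close>, hence \<open>|y - My/c|\<^sup>2 \<le> (1 - 2/c + (1 + K\<^sup>2)\<^sup>2/c\<^sup>2) |y|\<^sup>2\<close>. For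
  \<open>c = (1 + K\<^sup>2)\<^sup>2\<close> the factor is \<open>1 - 1/c\<close>. This choice depends only on the bound \<open>K\<close>, so \<open>c\<close> is the same for all
  \<open>V\<close> in a ball.
\<close>

lemma gram_shift_estimates:
  fixes V :: "real^'p^'n"
  assumes K: "norm V < K" and c: "c = (1 + K\<^sup>2)\<^sup>2"
  defines "X \<equiv> mat 1 - (1 / c) *\<^sub>R (mat 1 + transpose V ** V)"
  shows "transpose X = X" "0 \<le> inner y (X *v y)" "onorm ((*v) X) < 1" "0 < c"
    "mat 1 + transpose V ** V = c *\<^sub>R (mat 1 - X)"
proof -
  let ?M = "mat 1 + transpose V ** V"
  have K0: "0 < K" using K norm_ge_zero[of V] by linarith
  have "0 < 1 + K\<^sup>2" by (simp add: add_pos_nonneg)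
  then show c0: "0 < c" unfolding c by (rule zero_less_power)
  have c1: "1 < c" using K0 unfolding c by (intro one_less_power) simp_all
  show "?M = c *\<^sub>R (mat 1 - X)"
    using c0 by (simp add: X_def)
  have tM: "transpose ?M = ?M"
    by (simp add: linear_add[OF bounded_linear.linear[OF bounded_linear_transpose]] matrix_transpose_mul)
  show "transpose X = X"
    unfolding X_def
    by (simp only: linear_diff[OF bounded_linear.linear[OF bounded_linear_transpose]] transpose_scalar tM transpose_mat)
  have My: "inner y (?M *v y) = inner y y + inner (V *v y) (V *v y)" for y
  proof -
    have "inner y ((transpose V ** V) *v y) = inner (V *v y) (V *v y)"
      using dot_lmul_matrix[of y "transpose V" "V *v y"] transpose_matrix_vector[of "transpose V" y]
      by (simp add: matrix_vector_mul_assoc)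
    then show ?thesis by (simp add: matrix_vector_mult_add_rdistrib inner_add_right)
  qed
  have nM: "norm (?M *v y) \<le> (1 + K\<^sup>2) * norm y" for y
  proof -
    have "norm ((transpose V ** V) *v y) \<le> norm (transpose V) * (norm V * norm y)"
    proof -
      have n: "norm (A *v z) \<le> norm A * norm z" for A :: "real^'k^'l" and z
        using onorm[OF matrix_vector_mul_bounded_linear[of A], of z]
          mult_right_mono[OF onorm_matrix_le_norm[of A] norm_ge_zero[of z]] by linarith
      have "norm (transpose V *v (V *v y)) \<le> norm (transpose V) * norm (V *v y)"
        by (rule n)
      also have "\<dots> \<le> norm (transpose V) * (norm V * norm y)"
        by (intro mult_left_mono n norm_ge_zero)
      finally show ?thesis by (simp only: matrix_vector_mul_assoc)
    qed
    also have "\<dots> = norm V * norm V * norm y"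
      by (simp add: norm_transpose)
    also have "\<dots> \<le> K * K * norm y"
      using K K0 by (intro mult_mono) simp_all
    finally have "norm ((transpose V ** V) *v y) \<le> K * K * norm y" .
    then show ?thesis
      using norm_triangle_ineq[of y "(transpose V ** V) *v y"]
      by (simp add: matrix_vector_mult_add_rdistrib power2_eq_square algebra_simps)
  qed
  have Xy: "X *v y = y - (1 / c) *\<^sub>R (?M *v y)" for y
    by (simp add: X_def matrix_vector_mult_diff_rdistrib scaleR_matrix_vector_assoc[symmetric])
  have le: "1 + K\<^sup>2 \<le> c"
    unfolding c by (rule self_le_power) simp_all
  show "0 \<le> inner y (X *v y)"
  proof -
    have "inner y (?M *v y) \<le> norm y * norm (?M *v y)" by (rule norm_cauchy_schwarz)
    also have "\<dots> \<le> norm y * (c * norm y)"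
      using nM[of y] mult_right_mono[OF le norm_ge_zero[of y]] by (intro mult_left_mono) simp_all
    finally have "inner y (?M *v y) \<le> c * inner y y"
      by (simp add: dot_square_norm power2_eq_square mult_ac)
    then have "(1 / c) * inner y (?M *v y) \<le> inner y y"
      using c0 by (simp add: divide_le_eq mult.commute)
    then show ?thesis
      by (simp add: Xy inner_diff_right)
  qed
  have expand: "(norm (y - b *\<^sub>R z))\<^sup>2 = (norm y)\<^sup>2 - 2 * (b * inner y z) + b\<^sup>2 * (norm z)\<^sup>2"
    for y z :: "real^'p" and b
    by (simp only: power2_norm_eq_inner inner_diff_left inner_diff_right inner_commute[of z y]
        power2_eq_square[of b] inner_scaleR_left inner_scaleR_right) (simp add: algebra_simps)
  have "onorm ((*v) X) \<le> sqrt (1 - 1 / c)"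
  proof (rule onorm_le)
    fix y
    have "(norm (X *v y))\<^sup>2 = (norm y)\<^sup>2 - 2 * ((1 / c) * inner y (?M *v y)) + (1 / c)\<^sup>2 * (norm (?M *v y))\<^sup>2"
      unfolding Xy by (rule expand)
    also have "(norm (?M *v y))\<^sup>2 \<le> c * (norm y)\<^sup>2"
      using power_mono[OF nM[of y] norm_ge_zero, of 2] by (simp add: c power_mult_distrib)
    also have "(1 / c)\<^sup>2 * (c * (norm y)\<^sup>2) = (1 / c) * (norm y)\<^sup>2"
      using c0 by (simp add: power2_eq_square)
    finally have *: "(norm (X *v y))\<^sup>2 \<le> (norm y)\<^sup>2 - 2 * ((1 / c) * inner y (?M *v y)) + (1 / c) * (norm y)\<^sup>2"
      by (simp add: mult_left_mono)
    have "(norm y)\<^sup>2 \<le> inner y (?M *v y)"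
      unfolding My by (simp add: power2_norm_eq_inner)
    then have "(1 / c) * (norm y)\<^sup>2 \<le> (1 / c) * inner y (?M *v y)"
      using c0 by (intro mult_left_mono) simp_all
    then have "(norm (X *v y))\<^sup>2 \<le> (norm y)\<^sup>2 - (1 / c) * (norm y)\<^sup>2"
      using * by linarith
    also have "\<dots> = (sqrt (1 - 1 / c) * norm y)\<^sup>2"
      using c1 by (simp add: power_mult_distrib algebra_simps)
    finally show "norm (X *v y) \<le> sqrt (1 - 1 / c) * norm y"
      by (rule power2_le_imp_le) (use c1 in simp)
  qed
  also have "sqrt (1 - 1 / c) < 1" using c0 by simp
  finally show "onorm ((*v) X) < 1" .
qed

lemma inv_sqrt_gram:
  fixes V :: "real^'p^'n"
  defines "M \<equiv> mat 1 + transpose V ** V"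
  shows "spd (inv_sqrt M)" "inv_sqrt M ** inv_sqrt M ** M = mat 1"
proof -
  have K: "norm V < norm V + 1" by simp
  note est = gram_shift_estimates[OF K refl]
  note inv = inv_sqrt_eq_matseries[OF est, folded M_def]
  show "spd (inv_sqrt M)" "inv_sqrt M ** inv_sqrt M ** M = mat 1"
    unfolding inv(1) by (rule inv(2), rule inv(3))
qed

lemma Ck_on_inv_sqrt_gram:
  "Ck_on k (\<lambda>V :: real^'p^'n. inv_sqrt (mat 1 + transpose V ** V)) UNIV"
proof (rule Ck_on_localI)
  fix V0 :: "real^'p^'n"
  define K where "K = norm V0 + 1"
  define c where "c = (1 + K\<^sup>2)\<^sup>2"
  define X where "X V = mat 1 - (1 / c) *\<^sub>R (mat 1 + transpose V ** V)" for V :: "real^'p^'n"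
  define W where "W = {X :: real^'p^'p. onorm ((*v) X) < 1}"
  have est: "transpose (X V) = X V" "\<And>y. 0 \<le> inner y (X V *v y)" "onorm ((*v) (X V)) < 1" "0 < c"
    "mat 1 + transpose V ** V = c *\<^sub>R (mat 1 - X V)" if "V \<in> ball 0 K" for V
    unfolding X_def using that by (intro gram_shift_estimates[OF _ c_def]; simp)+
  have o: "open (ball (0 :: real^'p^'n) K)" by (rule open_ball)
  have sm: "Ck_on k (matseries inv_sqrt_coeff) W"
  proof (rule Ck_on_localI)
    fix Y assume "Y \<in> W"
    then obtain \<rho> where \<rho>: "onorm ((*v) Y) < \<rho>" "\<rho> < 1"
      using dense unfolding W_def by blast
    then have "0 \<le> \<rho>" using onorm_pos_le[OF matrix_vector_mul_bounded_linear[of Y]] by linarith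
    then show "\<exists>V. open V \<and> Y \<in> V \<and> Ck_on k (matseries inv_sqrt_coeff) V"
      using Ck_on_matseries[OF summable_inv_sqrt_coeff[OF _ \<rho>(2)]] \<rho>(1)
      by (intro exI[of _ "{Y. onorm ((*v) Y) < \<rho>}"]) (simp add: open_onorm_matrix_less)
  qed
  have "Ck_on k (\<lambda>V. transpose V ** V) (ball (0 :: real^'p^'n) K)"
    by (rule Ck_on_bilinear[OF bounded_bilinear_matrix_mult o
          Ck_on_bounded_linear[OF bounded_linear_transpose o Ck_on_id[OF o]] Ck_on_id[OF o]])
  then have "Ck_on k (\<lambda>V. (- 1 / c) *\<^sub>R (transpose V ** V)) (ball (0 :: real^'p^'n) K)"
    by (rule Ck_on_bounded_linear[OF bounded_linear_scaleR_right o])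
  then have "Ck_on k (\<lambda>V. (mat 1 - (1 / c) *\<^sub>R mat 1) + (- 1 / c) *\<^sub>R (transpose V ** V)) (ball (0 :: real^'p^'n) K)"
    by (rule Ck_on_add[OF o Ck_on_const[OF o]])
  then have "Ck_on k X (ball 0 K)"
    by (simp add: X_def[abs_def] scaleR_add_right algebra_simps)
  then have "Ck_on k (\<lambda>V. matseries inv_sqrt_coeff (X V)) (ball 0 K)"
    by (rule Ck_on_compose[OF o open_onorm_matrix_less _ _ sm[unfolded W_def], rotated]) (use est(3) in auto)
  then have "Ck_on k (\<lambda>V. (1 / sqrt c) *\<^sub>R matseries inv_sqrt_coeff (X V)) (ball 0 K)"
    by (rule Ck_on_bounded_linear[OF bounded_linear_scaleR_right o])
  moreover have "inv_sqrt (mat 1 + transpose V ** V) = (1 / sqrt c) *\<^sub>R matseries inv_sqrt_coeff (X V)"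
    if "V \<in> ball 0 K" for V
    by (rule inv_sqrt_eq_matseries(1)[OF est[OF that]])
  ultimately have "Ck_on k (\<lambda>V. inv_sqrt (mat 1 + transpose V ** V)) (ball (0 :: real^'p^'n) K)"
    using Ck_on_cong[OF o, of "\<lambda>V. inv_sqrt (mat 1 + transpose V ** V)"
        "\<lambda>V. (1 / sqrt c) *\<^sub>R matseries inv_sqrt_coeff (X V)"] by simp
  then show "\<exists>W. open W \<and> V0 \<in> W \<and> Ck_on k (\<lambda>V :: real^'p^'n. inv_sqrt (mat 1 + transpose V ** V)) W"
    by (intro exI[of _ "ball 0 K"]) (simp add: K_def)
qed

section \<open>Derivatives along lines\<close>

lemmas matrix_has_vector_derivative =
  bounded_bilinear.has_vector_derivative[OF bounded_bilinear_matrix_mult]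

lemma matexp_zero: "matexp (0 :: real^'m^'m) = mat 1"
proof -
  have "(\<lambda>k. if k = 0 then mat 1 else 0) sums (mat 1 :: real^'m^'m)"
    by (rule sums_single)
  moreover have "(1 / fact k) *\<^sub>R matpow (0 :: real^'m^'m) k = (if k = 0 then mat 1 else 0)" for k
    by (cases k) (simp_all add: matpow_Suc)
  ultimately have "(\<lambda>k. (1 / fact k) *\<^sub>R matpow (0 :: real^'m^'m) k) sums mat 1"
    by (simp only:)
  from sums_unique[OF this] show ?thesis
    by (simp only: matexp_eq_matseries matseries_def)
qed

text \<open>
  The transpose of \<open>exp(A)\<close> is \<open>exp(-A)\<close>. As a power series in \<open>A\<close> it has the coefficients \<open>(-1)\<^sup>k/k!\<close>, and its
  Cauchy product with \<open>exp(A)\<close> is \<open>I\<close>, since alternating sums of binomial coefficients vanish.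
\<close>

lemma matexp_skew_orthogonal:
  fixes A :: "real^'m^'m"
  assumes "A \<in> skew"
  shows "transpose (matexp A) ** matexp A = mat 1"
proof -
  define b :: "nat \<Rightarrow> real" where "b k = (- 1) ^ k / fact k" for k
  have sb: "summable (\<lambda>k. \<bar>b k\<bar> * r ^ k)" for r
    using summable_matexp_coeff[of r] by (simp add: b_def abs_mult power_abs)
  have "matpow (- A) k = (- 1) ^ k *\<^sub>R matpow A k" for k
    using matpow_scaleR[of "- 1" A k] by simp
  then have t: "transpose (matexp A) = matseries b A"
    using transpose_matseries[OF summable_matexp_coeff, of A] assms
    by (simp add: matexp_eq_matseries skew_def matseries_def[of _ "- A"] matseries_def[of b A] b_def)
  have "(\<Sum>k\<le>n. b k * (1 / fact (n - k))) = (if n = 0 then 1 else 0)" for n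
  proof -
    have "b k * (1 / fact (n - k)) = ((- 1) ^ k * of_nat (n choose k)) / fact n" if "k \<le> n" for k
      using that by (simp add: b_def binomial_fact)
    then have "(\<Sum>k\<le>n. b k * (1 / fact (n - k))) = (\<Sum>k\<le>n. (- 1) ^ k * of_nat (n choose k)) / fact n"
      by (simp add: sum_divide_distrib)
    then show ?thesis
      using choose_alternating_sum[of n, where 'a = real] by simp
  qed
  then have "(\<lambda>n. (if n = 0 then 1 else 0) *\<^sub>R matpow A n) sums (matseries b A ** matexp A)"
    using sums_matseries_mult[OF sb summable_matexp_coeff, of A] by (simp add: matexp_eq_matseries)
  moreover have "(\<lambda>n. (if n = 0 then 1 else 0) *\<^sub>R matpow A n) sums mat 1"
    using sums_single[of 0 "\<lambda>n. matpow A n"] by (simp add: if_distrib[of "\<lambda>s. s *\<^sub>R _"] cong: if_cong)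
  ultimately have "mat 1 = matseries b A ** matexp A"
    by (intro sums_unique2)
  with t show ?thesis by (simp only:)
qed

text \<open>
  Each component of \<open>exp(tX)\<close> is an everywhere convergent real power series in \<open>t\<close>, which can be
  differentiated term by term.
\<close>

lemma matexp_has_vector_derivative:
  fixes X :: "real^'m^'m"
  shows "((\<lambda>t. matexp (t *\<^sub>R X)) has_vector_derivative (X ** matexp (t *\<^sub>R X))) (at t)"
  unfolding has_vector_derivative_def
proof (subst has_derivative_componentwise_within, rule ballI)
  fix b :: "real^'m^'m"
  define c where "c k = inner (matpow X k) b / fact k" for k
  have "(\<lambda>k. inner ((1 / fact k) *\<^sub>R matpow (s *\<^sub>R X) k) b) sums inner (matexp (s *\<^sub>R X)) b" for s
    unfolding matexp_eq_matseries
    by (rule bounded_linear.sums[OF bounded_linear_inner_left sums_matseries[OF summable_matexp_coeff]])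
  then have s: "(\<lambda>k. c k * s ^ k) sums inner (matexp (s *\<^sub>R X)) b" for s
    by (simp add: matpow_scaleR c_def mult.commute)
  have "(\<lambda>k. inner (X ** ((1 / fact k) *\<^sub>R matpow (t *\<^sub>R X) k)) b) sums inner (X ** matexp (t *\<^sub>R X)) b"
    unfolding matexp_eq_matseries
    by (rule bounded_linear.sums[OF bounded_linear_inner_left
          bounded_linear.sums[OF bounded_bilinear.bounded_linear_right[OF bounded_bilinear_matrix_mult]
            sums_matseries[OF summable_matexp_coeff]]])
  moreover have "inner (X ** ((1 / fact k) *\<^sub>R matpow (t *\<^sub>R X) k)) b = diffs c k * t ^ k" for k
    by (simp add: diffs_def c_def matpow_scaleR matrix_mult_scaleR matpow_Suc field_simps del: of_nat_Suc)
  ultimately have d: "(\<lambda>k. diffs c k * t ^ k) sums inner (X ** matexp (t *\<^sub>R X)) b"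
    by simp
  have "((\<lambda>s. \<Sum>k. c k * s ^ k) has_field_derivative (\<Sum>k. diffs c k * t ^ k)) (at t)"
    by (rule termdiffs_strong_converges_everywhere[OF sums_summable[OF s]])
  then have "((\<lambda>s. inner (matexp (s *\<^sub>R X)) b) has_field_derivative inner (X ** matexp (t *\<^sub>R X)) b) (at t)"
    by (simp flip: sums_unique[OF s] sums_unique[OF d])
  then show "((\<lambda>s. inner (matexp (s *\<^sub>R X)) b) has_derivative
      (\<lambda>h. inner (h *\<^sub>R (X ** matexp (t *\<^sub>R X))) b)) (at t)"
    by (simp add: has_field_derivative_def mult.commute[of _ "inner _ _"])
qed

lemma taylor_term_0_1_2:
  assumes "\<And>t. f (t *\<^sub>R \<xi>) = g t"
    and "\<And>t. (g has_vector_derivative g1 t) (at t)" "(g1 has_vector_derivative g2) (at 0)"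
  shows "taylor_term f 0 \<xi> = g 0" "taylor_term f 1 \<xi> = g1 0" "taylor_term f 2 \<xi> = (1 / 2) *\<^sub>R g2"
proof -
  have g1: "(\<lambda>t. vector_derivative g (at t)) = g1"
    by (rule ext) (rule vector_derivative_at[OF assms(2)])
  show "taylor_term f 0 \<xi> = g 0" "taylor_term f 1 \<xi> = g1 0" "taylor_term f 2 \<xi> = (1 / 2) *\<^sub>R g2"
    using vector_derivative_at[OF assms(3)]
    by (simp_all add: taylor_term_def assms(1) g1 numeral_2_eq_2 fact_numeral)
qed

lemma add_self_eq_0D:
  fixes x :: "'a::real_vector"
  assumes "x + x = 0"
  shows "x = 0"
proof -
  have "2 *\<^sub>R x = 0" by (simp only: scaleR_2 assms)
  then show ?thesis by simp
qed

text \<open>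
  Differentiability of \<open>r\<close> is known from \<open>Ck_on_inv_sqrt_gram\<close>. The values of the derivatives at 0 follow
  from \<open>r(t)\<^sup>2 q(t) = I\<close> with \<open>q(t) = I + t\<^sup>2 G\<close>, \<open>G = V\<^sup>T V\<close>: one derivative gives \<open>2 r'(0) = 0\<close>, two give
  \<open>2 r''(0) + 2 G = 0\<close>.
\<close>

lemma inv_sqrt_gram_derivatives:
  fixes V :: "real^'p^'n"
  defines "r \<equiv> \<lambda>t. inv_sqrt (mat 1 + transpose (t *\<^sub>R V) ** (t *\<^sub>R V))"
  obtains r1 where "\<And>t. (r has_vector_derivative r1 t) (at t)"
    "(r1 has_vector_derivative - (transpose V ** V)) (at 0)" "r 0 = mat 1" "r1 0 = 0"
proof -
  define G where "G = transpose V ** V"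
  define q where "q t = mat 1 + (t * t) *\<^sub>R G" for t :: real
  have rq: "r t = inv_sqrt (q t)" for t
    by (simp add: r_def q_def G_def transpose_scalar matrix_mult_scaleR)
  have Ck: "Ck_on 2 r UNIV"
    unfolding r_def
    by (rule Ck_on_compose[OF open_UNIV open_UNIV _ _ Ck_on_inv_sqrt_gram])
      (simp_all add: Ck_on_bounded_linear[OF bounded_linear_scaleR_left open_UNIV Ck_on_id])
  define r1 where "r1 t = frechet_derivative r (at t) 1" for t
  define r2 where "r2 = frechet_derivative r1 (at 0) 1"
  have vd: "(f has_vector_derivative frechet_derivative f (at t) 1) (at t)"
    if "(f has_derivative frechet_derivative f (at t)) (at t)" for f :: "real \<Rightarrow> real^'p^'p" and t
  proof -
    have "frechet_derivative f (at t) h = h *\<^sub>R frechet_derivative f (at t) 1" for h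
      using linear_scale[OF has_derivative_linear[OF that], of h 1] by simp
    then have "frechet_derivative f (at t) = (\<lambda>h. h *\<^sub>R frechet_derivative f (at t) 1)"
      by (rule ext)
    with that show ?thesis
      unfolding has_vector_derivative_def by metis
  qed
  have Ck': "Ck_on (Suc (Suc 0)) r UNIV" using Ck by (simp only: numeral_2_eq_2)
  then have "Ck_on (Suc 0) (\<lambda>t. frechet_derivative r (at t) 1) UNIV"
    unfolding Ck_on.simps(2)[of "Suc 0"] by blast
  then have Ck1: "Ck_on (Suc 0) r1 UNIV"
    by (simp only: r1_def[abs_def])
  have r1: "(r has_vector_derivative r1 t) (at t)" for t
    unfolding r1_def by (rule vd[OF Ck_on_Suc_has_derivative[OF open_UNIV Ck' UNIV_I]])
  have r2: "(r1 has_vector_derivative r2) (at 0)"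
    unfolding r2_def by (rule vd[OF Ck_on_Suc_has_derivative[OF open_UNIV Ck1 UNIV_I]])
  have q': "(q has_vector_derivative (2 * t) *\<^sub>R G) (at t)" for t
    unfolding q_def by (auto intro!: derivative_eq_intros simp: has_vector_derivative_def scaleR_add_left[symmetric] algebra_simps)
  have spd: "spd (r t)" "r t ** r t ** q t = mat 1" for t
    using inv_sqrt_gram[of "t *\<^sub>R V"] unfolding r_def q_def G_def
    by (simp_all add: transpose_scalar matrix_mult_scaleR)
  have r0: "r 0 = mat 1"
  proof (rule spd_sqrt_unique[OF spd(1)])
    show "spd (mat 1 :: real^'p^'p)" by (simp add: spd_def)
    show "r 0 ** r 0 = mat 1 ** mat 1" using spd(2)[of 0] by (simp add: q_def)
  qed simp
  have P: "((\<lambda>t. r t ** r t) has_vector_derivative (r t ** r1 t + r1 t ** r t)) (at t)" for t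
    by (rule matrix_has_vector_derivative[OF r1 r1])
  have "((\<lambda>t. (r t ** r t) ** q t) has_vector_derivative
      ((r t ** r t) ** ((2 * t) *\<^sub>R G) + (r t ** r1 t + r1 t ** r t) ** q t)) (at t)" for t
    by (rule matrix_has_vector_derivative[OF P q'])
  \<comment> \<open>The product is the constant identity, so this derivative vanishes for every t
    and can be differentiated once more.\<close>
  then have const: "((\<lambda>t. mat 1 :: real^'p^'p) has_vector_derivative
      ((r t ** r t) ** ((2 * t) *\<^sub>R G) + (r t ** r1 t + r1 t ** r t) ** q t)) (at t)" for t
    by (simp add: spd(2))
  have zero: "(r t ** r t) ** ((2 * t) *\<^sub>R G) + (r t ** r1 t + r1 t ** r t) ** q t = 0" for t
    by (rule vector_derivative_unique_at[OF const has_vector_derivative_const])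
  have q0: "q 0 = mat 1" by (simp add: q_def)
  have "(r 0 ** r 0) ** ((2 * 0) *\<^sub>R G) + (r 0 ** r1 0 + r1 0 ** r 0) ** q 0 = r1 0 + r1 0"
    by (simp add: r0 q0)
  then have "r1 0 + r1 0 = 0"
    unfolding zero[of 0] by (rule sym)
  then have r10: "r1 0 = 0"
    by (rule add_self_eq_0D)
  have G': "((\<lambda>t. (2 * t) *\<^sub>R G) has_vector_derivative 2 *\<^sub>R G) (at 0)"
    by (auto intro!: derivative_eq_intros simp: has_vector_derivative_def)
  have "((\<lambda>t. (r t ** r t) ** ((2 * t) *\<^sub>R G) + (r t ** r1 t + r1 t ** r t) ** q t) has_vector_derivative
      ((r 0 ** r 0) ** (2 *\<^sub>R G) + (r 0 ** r1 0 + r1 0 ** r 0) ** ((2 * 0) *\<^sub>R G)) +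
      ((r 0 ** r1 0 + r1 0 ** r 0) ** ((2 * 0) *\<^sub>R G) +
        ((r 0 ** r2 + r1 0 ** r1 0) + (r1 0 ** r1 0 + r2 ** r 0)) ** q 0)) (at 0)"
    by (intro has_vector_derivative_add matrix_has_vector_derivative P G' q' r1 r2)
  then have "((\<lambda>t :: real. 0 :: real^'p^'p) has_vector_derivative
      ((r 0 ** r 0) ** (2 *\<^sub>R G) + (r 0 ** r1 0 + r1 0 ** r 0) ** ((2 * 0) *\<^sub>R G)) +
      ((r 0 ** r1 0 + r1 0 ** r 0) ** ((2 * 0) *\<^sub>R G) +
        ((r 0 ** r2 + r1 0 ** r1 0) + (r1 0 ** r1 0 + r2 ** r 0)) ** q 0)) (at 0)"
    unfolding zero .
  from vector_derivative_unique_at[OF this has_vector_derivative_const]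
  have sum0: "2 *\<^sub>R G + (r2 + r2) = 0"
    by (simp add: r0 r10 q0)
  have "(r2 + G) + (r2 + G) = 2 *\<^sub>R G + (r2 + r2)"
    by (simp only: scaleR_2 ac_simps)
  then have "(r2 + G) + (r2 + G) = 0"
    unfolding sum0 .
  then have "r2 + G = 0"
    by (rule add_self_eq_0D)
  then have "r2 = - G"
    by (simp only: eq_neg_iff_add_eq_0)
  with r2 have "(r1 has_vector_derivative - (transpose V ** V)) (at 0)"
    by (simp only: G_def)
  from that[OF r1 this r0 r10] show thesis .
qed

section \<open>The retraction on the Stiefel manifold\<close>

lemma tangent_space_scaleR:
  fixes U :: "real^'p^'n"
  assumes "CARD('p) \<le> CARD('n)" "\<xi> \<in> tangent_space U"
  shows "t *\<^sub>R \<xi> \<in> tangent_space U"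
proof -
  obtain Q A B where *: "orth_completion U Q" "A \<in> skew" "B \<in> trailing_rows" "\<xi> = Q ** vstack A B"
    using assms(2) by (auto simp: tangent_space_def)
  have "t *\<^sub>R vstack A B = vstack (t *\<^sub>R A) (t *\<^sub>R B)"
    by (simp add: vstack_def vec_eq_iff)
  then have "t *\<^sub>R \<xi> = Q ** vstack (t *\<^sub>R A) (t *\<^sub>R B)"
    using matrix_mult_scaleR(2)[of Q t "vstack A B"] by (simp only: *(4))
  moreover have "t *\<^sub>R A \<in> skew" "t *\<^sub>R B \<in> trailing_rows"
    using *(2,3) by (simp_all add: skew_def trailing_rows_def transpose_scalar)
  ultimately show ?thesis
    using *(1) unfolding tangent_space_def by blast
qed

text \<open>
  For orthonormal \<open>U\<close>, the component of \<open>\<xi>\<close> whose columns are orthogonal to those of \<open>U\<close>; it is the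
  summand \<open>Q ** B\<close> of a tangent vector \<open>Q ** vstack A B\<close>.
\<close>

definition normal_part :: "real^'p^'n \<Rightarrow> real^'p^'n \<Rightarrow> real^'p^'n"
  where "normal_part U \<xi> = \<xi> - U ** (transpose U ** \<xi>)"

lemma normal_part_scaleR: "normal_part U (t *\<^sub>R \<xi>) = t *\<^sub>R normal_part U \<xi>"
  by (simp add: normal_part_def matrix_mult_scaleR scaleR_diff_right)

lemma transpose_mult_normal_part:
  assumes "U \<in> stiefel"
  shows "transpose U ** normal_part U \<xi> = 0" "transpose (normal_part U \<xi>) ** U = 0"
proof -
  show 1: "transpose U ** normal_part U \<xi> = 0"
    using assms by (simp add: normal_part_def stiefel_def matrix_mult_linear matrix_mul_assoc)
  show "transpose (normal_part U \<xi>) ** U = 0"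
    using arg_cong[OF 1, of transpose]
    by (simp add: matrix_transpose_mul linear_0[OF bounded_linear.linear[OF bounded_linear_transpose]])
qed

lemma
  fixes U :: "real^'p^'n"
  assumes "CARD('p) \<le> CARD('n)" "\<xi> \<in> tangent_space U"
  shows tangential_part_skew: "transpose U ** \<xi> \<in> skew"
    and stiefel_phi_closed_form: "stiefel_phi U \<xi> =
      (U ** matexp (transpose U ** \<xi>) + normal_part U \<xi>) **
        inv_sqrt (mat 1 + transpose (normal_part U \<xi>) ** normal_part U \<xi>)"
    and stiefel_exp_closed_form: "stiefel_exp \<beta> U \<xi> =
      matexp ((U ** ((2 * \<beta>) *\<^sub>R (transpose U ** \<xi>)) + normal_part U \<xi>) ** transpose U
          - U ** transpose (normal_part U \<xi>))
        ** U ** matexp ((1 - 2 * \<beta>) *\<^sub>R (transpose U ** \<xi>))"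
proof -
  obtain Q A B where *: "orth_completion U Q" "A \<in> skew" "B \<in> trailing_rows" "\<xi> = Q ** vstack A B"
    using assms(2) by (auto simp: tangent_space_def)
  show "transpose U ** \<xi> \<in> skew"
    using completion_unique(1)[OF assms(1) *(1,3,4)] *(2) by simp
  show "stiefel_phi U \<xi> = (U ** matexp (transpose U ** \<xi>) + normal_part U \<xi>) **
        inv_sqrt (mat 1 + transpose (normal_part U \<xi>) ** normal_part U \<xi>)"
    using stiefel_phi_eq[OF assms(1) *(1-3)] stiefel_phi_closed[OF assms(1) *(1,3,4)]
    by (simp only: normal_part_def flip: *(4))
  show "stiefel_exp \<beta> U \<xi> =
      matexp ((U ** ((2 * \<beta>) *\<^sub>R (transpose U ** \<xi>)) + normal_part U \<xi>) ** transpose U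
          - U ** transpose (normal_part U \<xi>))
        ** U ** matexp ((1 - 2 * \<beta>) *\<^sub>R (transpose U ** \<xi>))"
    using stiefel_exp_eq[OF assms(1) *(1-3), of \<beta>] stiefel_exp_closed[OF assms(1) *(1,3,4), of \<beta>]
    by (simp only: normal_part_def flip: *(4))
qed

text \<open>
  The mixed terms of the Gram matrix of \<open>U exp(A) + V\<close> vanish because \<open>U\<^sup>T V = 0\<close>.
\<close>

lemma stiefel_phi_in_stiefel:
  fixes U :: "real^'p^'n"
  assumes "CARD('p) \<le> CARD('n)" "U \<in> stiefel" "\<xi> \<in> tangent_space U"
  shows "stiefel_phi U \<xi> \<in> stiefel"
proof -
  define E where "E = matexp (transpose U ** \<xi>)"
  define V where "V = normal_part U \<xi>"
  define R where "R = inv_sqrt (mat 1 + transpose V ** V)"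
  note orth = transpose_mult_normal_part[OF assms(2), of \<xi>, folded V_def]
  have E: "transpose E ** E = mat 1"
    unfolding E_def by (rule matexp_skew_orthogonal[OF tangential_part_skew[OF assms(1,3)]])
  have R: "transpose R = R" "R ** R ** (mat 1 + transpose V ** V) = mat 1"
    using inv_sqrt_gram[of V] by (simp_all add: R_def spd_def)
  have "transpose (U ** E + V) ** (U ** E + V) =
      (transpose E ** transpose U + transpose V) ** (U ** E + V)"
    by (simp add: linear_add[OF bounded_linear.linear[OF bounded_linear_transpose]] matrix_transpose_mul)
  also have "\<dots> = transpose E ** (transpose U ** U) ** E + transpose E ** (transpose U ** V)
      + (transpose V ** U) ** E + transpose V ** V"
    by (simp only: matrix_mult_linear matrix_mul_assoc add.assoc)
      (simp only: ac_simps)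
  also have "\<dots> = mat 1 + transpose V ** V"
    using assms(2) by (simp add: orth stiefel_def E)
  finally have P: "transpose (U ** E + V) ** (U ** E + V) = mat 1 + transpose V ** V" .
  have phi: "stiefel_phi U \<xi> = (U ** E + V) ** R"
    unfolding stiefel_phi_closed_form[OF assms(1,3)] E_def V_def R_def ..
  have "R ** (R ** (mat 1 + transpose V ** V)) = mat 1"
    using R(2) by (simp only: matrix_mul_assoc)
  then have "(R ** (mat 1 + transpose V ** V)) ** R = mat 1"
    using matrix_left_right_inverse by blast
  moreover have "transpose (stiefel_phi U \<xi>) ** stiefel_phi U \<xi> =
      R ** (transpose (U ** E + V) ** (U ** E + V)) ** R"
    by (simp only: phi matrix_transpose_mul R(1) matrix_mul_assoc)
  ultimately show ?thesis
    by (simp add: stiefel_def P)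
qed

text \<open>
  \<open>I + V\<^sup>T V\<close> is positive definite for every \<open>V\<close>, so the closed form is smooth on the whole space of
  pairs of matrices, and one global extension serves at all points of the tangent bundle.
\<close>

lemma smooth_stiefel_phi:
  assumes "CARD('p) \<le> CARD('n)"
  shows "smooth_map_on tangent_bundle
    (\<lambda>(U :: real^'p^'n, \<xi>). stiefel_phi U \<xi>)"
proof -
  let ?N = "\<lambda>z. normal_part (fst z) (snd z) :: real^'p^'n"
  define g where "g z = (fst z ** matexp (transpose (fst z) ** snd z) + ?N z) **
    inv_sqrt (mat 1 + transpose (?N z) ** ?N z)" for z
  note o = open_UNIV and B = Ck_on_bilinear[OF bounded_bilinear_matrix_mult open_UNIV]
  have "Ck_on k g UNIV" for k
  proof -
    have fst: "Ck_on k (fst :: (real^'p^'n) \<times> (real^'p^'n) \<Rightarrow> _) UNIV"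
      by (rule Ck_on_bounded_linear[OF bounded_linear_fst o Ck_on_id[OF o]])
    have snd: "Ck_on k (snd :: (real^'p^'n) \<times> (real^'p^'n) \<Rightarrow> _) UNIV"
      by (rule Ck_on_bounded_linear[OF bounded_linear_snd o Ck_on_id[OF o]])
    have A: "Ck_on k (\<lambda>z :: (real^'p^'n) \<times> (real^'p^'n). transpose (fst z) ** snd z) UNIV"
      by (rule B[OF Ck_on_bounded_linear[OF bounded_linear_transpose o fst] snd])
    have "Ck_on k (\<lambda>z :: (real^'p^'n) \<times> (real^'p^'n). snd z + (- 1) *\<^sub>R (fst z ** (transpose (fst z) ** snd z))) UNIV"
      by (rule Ck_on_add[OF o snd Ck_on_bounded_linear[OF bounded_linear_scaleR_right o B[OF fst A]]])
    then have N: "Ck_on k ?N UNIV"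
      by (simp add: normal_part_def)
    have E: "Ck_on k (\<lambda>z :: (real^'p^'n) \<times> (real^'p^'n). matexp (transpose (fst z) ** snd z)) UNIV"
      by (rule Ck_on_compose[OF o o subset_UNIV A Ck_on_matexp])
    have S: "Ck_on k (\<lambda>z. inv_sqrt (mat 1 + transpose (?N z) ** ?N z)) UNIV"
      by (rule Ck_on_compose[OF o o subset_UNIV N Ck_on_inv_sqrt_gram])
    show ?thesis
      unfolding g_def[abs_def] by (rule B[OF Ck_on_add[OF o B[OF fst E] N] S])
  qed
  moreover have "g z = (\<lambda>(U, \<xi>). stiefel_phi U \<xi>) z" if "z \<in> tangent_bundle" for z
    using that by (auto simp: tangent_bundle_def g_def stiefel_phi_closed_form[OF assms])
  ultimately show ?thesis
    unfolding smooth_map_on_def by (intro ballI exI[of _ UNIV] exI[of _ g]) simp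
qed

text \<open>
  Along \<open>t\<xi>\<close> the map is \<open>p(t) r(t)\<close> with \<open>p(t) = U exp(tA) + tV\<close>. Since \<open>r'(0) = 0\<close>, the second
  derivative at 0 is \<open>p''(0) + U r''(0)\<close>: there is no mixed term.
\<close>

lemma taylor_stiefel_phi:
  fixes U :: "real^'p^'n"
  assumes "CARD('p) \<le> CARD('n)" "\<xi> \<in> tangent_space U"
  defines "A \<equiv> transpose U ** \<xi>" and "V \<equiv> normal_part U \<xi>"
  shows "taylor_term (stiefel_phi U) 0 \<xi> = U"
    "taylor_term (stiefel_phi U) 1 \<xi> = U ** A + V"
    "taylor_term (stiefel_phi U) 2 \<xi> =
      (1 / 2) *\<^sub>R (U ** (A ** A) - U ** (transpose V ** V))"
proof -
  define r where "r t = inv_sqrt (mat 1 + transpose (t *\<^sub>R V) ** (t *\<^sub>R V))" for t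
  obtain r1 where r: "\<And>t. (r has_vector_derivative r1 t) (at t)"
    "(r1 has_vector_derivative - (transpose V ** V)) (at 0)" "r 0 = mat 1" "r1 0 = 0"
    using inv_sqrt_gram_derivatives[of V] unfolding r_def[abs_def] by blast
  define E where "E t = matexp (t *\<^sub>R A)" for t
  have E: "(E has_vector_derivative A ** E t) (at t)" for t
    unfolding E_def[abs_def] by (rule matexp_has_vector_derivative)
  have E0: "E 0 = mat 1" by (simp add: E_def matexp_zero)
  have c: "(f has_vector_derivative f') F \<Longrightarrow> ((\<lambda>t. Y ** f t) has_vector_derivative Y ** f') F"
    for f f' F and Y :: "real^'k^'l"
    by (rule bounded_linear.has_vector_derivative[OF
          bounded_bilinear.bounded_linear_right[OF bounded_bilinear_matrix_mult]])
  have tV: "((\<lambda>t. t *\<^sub>R V) has_vector_derivative V) (at t)" for t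
    by (auto intro!: derivative_eq_intros simp: has_vector_derivative_def)
  define p p1 where "p t = U ** E t + t *\<^sub>R V" and "p1 t = U ** (A ** E t) + V" for t
  have p: "(p has_vector_derivative p1 t) (at t)" for t
    unfolding p_def[abs_def] p1_def by (intro has_vector_derivative_add c E tV)
  have p1: "(p1 has_vector_derivative U ** (A ** (A ** E t)) + 0) (at t)" for t
    unfolding p1_def[abs_def] by (intro has_vector_derivative_add c E has_vector_derivative_const)
  have phi: "stiefel_phi U (t *\<^sub>R \<xi>) = p t ** r t" for t
    unfolding stiefel_phi_closed_form[OF assms(1) tangent_space_scaleR[OF assms(1,2)]] p_def r_def E_def
    by (simp add: normal_part_scaleR matrix_mult_scaleR A_def V_def)
  have g: "((\<lambda>t. p t ** r t) has_vector_derivative p t ** r1 t + p1 t ** r t) (at t)" for t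
    by (rule matrix_has_vector_derivative[OF p r(1)])
  have g1: "((\<lambda>t. p t ** r1 t + p1 t ** r t) has_vector_derivative
      (p 0 ** (- (transpose V ** V)) + p1 0 ** r1 0) +
      (p1 0 ** r1 0 + (U ** (A ** (A ** E 0)) + 0) ** r 0)) (at 0)"
    by (rule has_vector_derivative_add[OF matrix_has_vector_derivative[OF p r(2)]
          matrix_has_vector_derivative[OF p1 r(1)]])
  note T = taylor_term_0_1_2[OF phi g g1]
  have neg: "U ** (- Z) = - (U ** Z)" for Z :: "real^'p^'p"
    using matrix_mult_scaleR(2)[of U "- 1" Z] by simp
  show "taylor_term (stiefel_phi U) 0 \<xi> = U"
    unfolding T(1) by (simp add: p_def E0 r)
  show "taylor_term (stiefel_phi U) 1 \<xi> = U ** A + V"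
    unfolding T(2) by (simp add: p_def p1_def E0 r)
  show "taylor_term (stiefel_phi U) 2 \<xi> = (1 / 2) *\<^sub>R (U ** (A ** A) - U ** (transpose V ** V))"
    unfolding T(3) by (simp add: p_def p1_def E0 r neg)
qed

text \<open>
  The exponential along \<open>t\<xi>\<close> is \<open>exp(tG) U exp(tB)\<close> with \<open>B = (1 - 2\<beta>) A\<close>, whose second derivative at 0 is
  \<open>U B\<^sup>2 + 2 G U B + G\<^sup>2 U\<close>. The result shows how far the retraction is from second order: the defect \<open>(1 - \<beta>) V A\<close> is
  zero for the Euclidean metric.
\<close>

lemma taylor_stiefel_exp:
  fixes U :: "real^'p^'n"
  assumes "CARD('p) \<le> CARD('n)" "U \<in> stiefel" "\<xi> \<in> tangent_space U"
  defines "A \<equiv> transpose U ** \<xi>" and "V \<equiv> normal_part U \<xi>"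
  shows "taylor_term (stiefel_exp \<beta> U) 0 \<xi> = U"
    "taylor_term (stiefel_exp \<beta> U) 1 \<xi> = U ** A + V"
    "taylor_term (stiefel_exp \<beta> U) 2 \<xi> =
      (1 / 2) *\<^sub>R (U ** (A ** A) - U ** (transpose V ** V)) + (1 - \<beta>) *\<^sub>R (V ** A)"
proof -
  define G where "G = (U ** ((2 * \<beta>) *\<^sub>R A) + V) ** transpose U - U ** transpose V"
  define B where "B = (1 - 2 * \<beta>) *\<^sub>R A"
  have UU: "transpose U ** U = mat 1" using assms(2) by (simp add: stiefel_def)
  note orth = transpose_mult_normal_part[OF assms(2), of \<xi>, folded V_def]
  have GU: "G ** U = (2 * \<beta>) *\<^sub>R (U ** A) + V"
    unfolding G_def matrix_mult_linear
    by (simp add: UU orth matrix_mult_scaleR flip: matrix_mul_assoc)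
  have UB: "U ** B = (1 - 2 * \<beta>) *\<^sub>R (U ** A)"
    by (simp add: B_def matrix_mult_scaleR)
  have GV: "G ** V = - (U ** (transpose V ** V))"
    unfolding G_def matrix_mult_linear
    by (simp add: orth flip: matrix_mul_assoc)
  define E F where "E t = matexp (t *\<^sub>R G)" and "F t = matexp (t *\<^sub>R B)" for t
  have E: "(E has_vector_derivative G ** E t) (at t)" and F: "(F has_vector_derivative B ** F t) (at t)" for t
    unfolding E_def[abs_def] F_def[abs_def] by (rule matexp_has_vector_derivative)+
  have EF0: "E 0 = mat 1" "F 0 = mat 1" by (simp_all add: E_def F_def matexp_zero)
  have l: "(f has_vector_derivative f') H \<Longrightarrow> ((\<lambda>t. Y ** f t) has_vector_derivative Y ** f') H"
    for f f' H and Y :: "real^'k^'l"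
    by (rule bounded_linear.has_vector_derivative[OF
          bounded_bilinear.bounded_linear_right[OF bounded_bilinear_matrix_mult]])
  have r: "(f has_vector_derivative f') H \<Longrightarrow> ((\<lambda>t. f t ** Y) has_vector_derivative f' ** Y) H"
    for f f' H and Y :: "real^'k^'l"
    by (rule bounded_linear.has_vector_derivative[OF
          bounded_bilinear.bounded_linear_left[OF bounded_bilinear_matrix_mult]])
  have exp: "stiefel_exp \<beta> U (t *\<^sub>R \<xi>) = (E t ** U) ** F t" for t
  proof -
    have "(U ** ((2 * \<beta>) *\<^sub>R (t *\<^sub>R A)) + t *\<^sub>R V) ** transpose U - U ** transpose (t *\<^sub>R V) = t *\<^sub>R G"
      unfolding G_def
      by (simp add: matrix_mult_scaleR matrix_mult_linear transpose_scalar scaleR_add_right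
          scaleR_diff_right mult_ac)
    moreover have "(1 - 2 * \<beta>) *\<^sub>R (t *\<^sub>R A) = t *\<^sub>R B"
      by (simp add: B_def mult.commute)
    moreover have "transpose U ** (t *\<^sub>R \<xi>) = t *\<^sub>R A"
      by (simp add: matrix_mult_scaleR A_def)
    ultimately show ?thesis
      unfolding stiefel_exp_closed_form[OF assms(1) tangent_space_scaleR[OF assms(1,3)]] E_def F_def
      by (simp only: normal_part_scaleR flip: V_def)
  qed
  have g: "((\<lambda>t. (E t ** U) ** F t) has_vector_derivative
      (E t ** U) ** (B ** F t) + ((G ** E t) ** U) ** F t) (at t)" for t
    by (rule matrix_has_vector_derivative[OF r[OF E] F])
  have g1: "((\<lambda>t. (E t ** U) ** (B ** F t) + ((G ** E t) ** U) ** F t) has_vector_derivative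
      ((E 0 ** U) ** (B ** (B ** F 0)) + ((G ** E 0) ** U) ** (B ** F 0)) +
      (((G ** E 0) ** U) ** (B ** F 0) + ((G ** (G ** E 0)) ** U) ** F 0)) (at 0)"
    by (rule has_vector_derivative_add[OF matrix_has_vector_derivative[OF r[OF E] l[OF F]]
          matrix_has_vector_derivative[OF r[OF l[OF E]] F]])
  note T = taylor_term_0_1_2[OF exp g g1]
  show "taylor_term (stiefel_exp \<beta> U) 0 \<xi> = U"
    unfolding T(1) by (simp add: EF0)
  show "taylor_term (stiefel_exp \<beta> U) 1 \<xi> = U ** A + V"
    unfolding T(2) by (simp add: EF0 GU UB algebra_simps)
  have UBB: "U ** (B ** B) = ((1 - 2 * \<beta>) * (1 - 2 * \<beta>)) *\<^sub>R (U ** (A ** A))"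
    by (simp add: B_def matrix_mult_scaleR)
  have GUB: "(G ** U) ** B = (2 * \<beta> * (1 - 2 * \<beta>)) *\<^sub>R (U ** (A ** A)) + (1 - 2 * \<beta>) *\<^sub>R (V ** A)"
    unfolding GU matrix_mult_linear
    by (simp add: B_def matrix_mult_scaleR scaleR_add_right mult.commute flip: matrix_mul_assoc)
  have GGU: "(G ** G) ** U = (2 * \<beta> * (2 * \<beta>)) *\<^sub>R (U ** (A ** A)) + (2 * \<beta>) *\<^sub>R (V ** A)
      - U ** (transpose V ** V)"
  proof -
    have "(G ** G) ** U = G ** (G ** U)"
      by (simp only: matrix_mul_assoc)
    also have "\<dots> = (2 * \<beta>) *\<^sub>R (G ** (U ** A)) + G ** V"
      by (simp only: GU matrix_mult_linear matrix_mult_scaleR)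
    also have "G ** (U ** A) = (G ** U) ** A"
      by (simp only: matrix_mul_assoc)
    also have "\<dots> = (2 * \<beta>) *\<^sub>R (U ** (A ** A)) + V ** A"
      by (simp only: GU matrix_mult_linear matrix_mult_scaleR matrix_mul_assoc)
    finally show ?thesis
      by (simp add: GV scaleR_add_right)
  qed
  \<comment> \<open>Stated for free matrices, because componentwise simplification must not unfold
    the products in the terms.\<close>
  have collect: "(s * s) *\<^sub>R x + (2 * \<beta> * s) *\<^sub>R x + s *\<^sub>R y + ((2 * \<beta> * s) *\<^sub>R x + s *\<^sub>R y
      + ((2 * \<beta> * (2 * \<beta>)) *\<^sub>R x + (2 * \<beta>) *\<^sub>R y - z)) = x - z + (2 * (1 - \<beta>)) *\<^sub>R y"
    if "s = 1 - 2 * \<beta>" for x y z :: "real^'p^'n" and s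
    by (simp add: that vec_eq_iff algebra_simps)
  have "((E 0 ** U) ** (B ** (B ** F 0)) + ((G ** E 0) ** U) ** (B ** F 0)) +
      (((G ** E 0) ** U) ** (B ** F 0) + ((G ** (G ** E 0)) ** U) ** F 0) =
      U ** (A ** A) - U ** (transpose V ** V) + (2 * (1 - \<beta>)) *\<^sub>R (V ** A)"
    unfolding EF0 matrix_mul_lid matrix_mul_rid UBB GUB GGU
    using collect[OF refl, of "U ** (A ** A)" "V ** A" "U ** (transpose V ** V)"]
    by (simp only: add.assoc)
  then show "taylor_term (stiefel_exp \<beta> U) 2 \<xi> =
      (1 / 2) *\<^sub>R (U ** (A ** A) - U ** (transpose V ** V)) + (1 - \<beta>) *\<^sub>R (V ** A)"
    unfolding T(3) by (simp add: scaleR_add_right)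
qed

theorem lemma3p3:
  assumes "CARD('p::finite) \<le> CARD('n::finite)"
  shows "(\<forall>\<beta>>0. is_retraction \<beta> (stiefel_phi :: real^'p^'n \<Rightarrow> real^'p^'n \<Rightarrow> real^'p^'n)) \<and>
    retraction_of_order 1 2 (stiefel_phi :: real^'p^'n \<Rightarrow> real^'p^'n \<Rightarrow> real^'p^'n)"
proof -
  have order1: "taylor_term (stiefel_phi U) j \<xi> = taylor_term (stiefel_exp \<beta> U) j \<xi>"
    if "U \<in> stiefel" "j \<le> 1" "\<xi> \<in> tangent_space U" for \<beta> j and U \<xi> :: "real^'p^'n"
  proof -
    have "j = 0 \<or> j = 1" using that(2) by auto
    then show ?thesis
      using taylor_stiefel_phi(1,2)[OF assms that(3)] taylor_stiefel_exp(1,2)[OF assms that(1,3), of \<beta>]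
      by (elim disjE) (simp_all only:)
  qed
  have order2: "taylor_term (stiefel_phi U) j \<xi> = taylor_term (stiefel_exp 1 U) j \<xi>"
    if "U \<in> stiefel" "j \<le> 2" "\<xi> \<in> tangent_space U" for j and U \<xi> :: "real^'p^'n"
  proof (cases "j \<le> 1")
    case False
    then have "j = 2" using that(2) by linarith
    then show ?thesis
      by (simp add: taylor_stiefel_phi(3)[OF assms that(3)] taylor_stiefel_exp(3)[OF assms that(1,3)])
  qed (use order1 that in blast)
  show ?thesis
    unfolding retraction_of_order_def
    using stiefel_phi_in_stiefel[OF assms] smooth_stiefel_phi[OF assms] order1 order2 by blast
qed

end
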